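(* Let $X$ be a real linear Polish space, let $D\subset X$ be a nonempty open convex set, let $Y$ be a real linear topological space, and let $n\in\mathbb{N}$. If $f:D\to Y$ is a $\mathcal{D}$-measurable polynomial function of $n$-th order, then $f$ is continuous.
   Context: A real linear Polish space is a real topological vector space whose topology is Polish (separable and completely metrizable). A linear topological space is a topological vector space. $\mathbb{N}$ is the set of positive integers. A set $A\subset X$ is Haar meager if there are a Borel set $B\subset X$ with $A\subset B$, a nonempty compact metric space $K$ and a continuous function $g:K\to X$ such that $g^{-1}(B+x)$ is meager in $K$ for every $x\in X$. A set $A\subset X$ is $\mathcal{D}$-measurable if $A=B\cup M$ for some Borel set $B\subset X$ and some Haar meager set $M\subset X$. A function $f:D\to Y$ is $\mathcal{D}$-measurable if $f^{-1}(U)$ is a $\mathcal{D}$-measurable subset of $X$ for each open set $U\subset Y$. A function $f:D\to Y$ is a polynomial function of $n$-th order if $$\Delta_h^{n+1}f(x):=\sum_{j=0}^{n+1}(-1)^{n+1-j}\binom{n+1}{j}f(x+jh)=0$$ for all $x\in D$ and $h\in X$ such that $x+ih\in D$ for every $i\in\{0,1,\ldots,n+1\}$. *)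

theory Defs
  imports "HOL-Analysis.Analysis"
begin

text \<open>
  Real topological vector spaces.  No separation axiom is included.
\<close>

class real_topological_vector = real_vector + topological_ab_group_add +
  assumes tendsto_scaleR_Pair:
    "LIM p (nhds (c :: real) \<times>\<^sub>F nhds x). fst p *\<^sub>R snd p :> nhds (c *\<^sub>R x)"

lemma continuous_on_scaleR_prod:
  "continuous_on UNIV (\<lambda>(c :: real, x :: 'a::real_topological_vector). c *\<^sub>R x)"
proof -
  have "((\<lambda>p. fst p *\<^sub>R snd p) \<longlongrightarrow> c *\<^sub>R x) (at (c, x))" for c :: real and x :: 'a
    using tendsto_mono[OF at_within_le_nhds tendsto_scaleR_Pair[of c x, folded nhds_prod]] .
  then show ?thesis
    by (auto simp: continuous_on_def case_prod_unfold)
qed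

instance real_normed_vector \<subseteq> real_topological_vector
proof
  fix c :: real and x :: 'a
  show "LIM p (nhds c \<times>\<^sub>F nhds x). fst p *\<^sub>R snd p :> nhds (c *\<^sub>R x)"
    by (intro tendsto_scaleR filterlim_fst filterlim_snd)
qed

definition nowhere_dense_in :: "'a topology \<Rightarrow> 'a set \<Rightarrow> bool" where
  "nowhere_dense_in T S \<longleftrightarrow> S \<subseteq> topspace T \<and> T interior_of (T closure_of S) = {}"

definition meager_in :: "'a topology \<Rightarrow> 'a set \<Rightarrow> bool" where
  "meager_in T S \<longleftrightarrow> (\<exists>\<F>. countable \<F> \<and> (\<forall>N\<in>\<F>. nowhere_dense_in T N) \<and> S = \<Union>\<F>)"

definition haar_meager_witness ::
    "'k metric \<Rightarrow> ('k \<Rightarrow> 'a) \<Rightarrow> 'a::real_topological_vector set \<Rightarrow> bool" where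
  "haar_meager_witness K g B \<longleftrightarrow>
     mspace K \<noteq> {} \<and> compact_space (mtopology_of K) \<and>
     continuous_map (mtopology_of K) euclidean g \<and>
     (\<forall>x. meager_in (mtopology_of K) {k \<in> mspace K. g k \<in> (\<lambda>b. b + x) ` B})"

text \<open>
  The compact metric space is an abstract metric space with an arbitrary set of reals as carrier
  and an arbitrary metric, unrelated to the usual one.  As every compact metric space has at most
  continuum many points, this covers all compact metric spaces up to isometry; see
  \<open>haar_meagerI\<close> below.
\<close>

definition haar_meager :: "'a::real_topological_vector set \<Rightarrow> bool" where
  "haar_meager A \<longleftrightarrow>
     (\<exists>B \<in> sets borel. A \<subseteq> B \<and> (\<exists>(K :: real metric) g. haar_meager_witness K g B))"

definition D_measurable_set :: "'a::real_topological_vector set \<Rightarrow> bool" where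
  "D_measurable_set A \<longleftrightarrow> (\<exists>B M. B \<in> sets borel \<and> haar_meager M \<and> A = B \<union> M)"

text \<open>
  Functions on \<open>D\<close> are total functions whose values outside \<open>D\<close> are irrelevant.
\<close>

definition D_measurable_on ::
    "'a::real_topological_vector set \<Rightarrow> ('a \<Rightarrow> 'b::topological_space) \<Rightarrow> bool" where
  "D_measurable_on D f \<longleftrightarrow> (\<forall>U. open U \<longrightarrow> D_measurable_set {x \<in> D. f x \<in> U})"

definition fdiff :: "nat \<Rightarrow> 'a::real_vector \<Rightarrow> ('a \<Rightarrow> 'b::real_vector) \<Rightarrow> 'a \<Rightarrow> 'b" where
  "fdiff m h f x =
     (\<Sum>j=0..m. ((-1) ^ (m - j) * real (m choose j)) *\<^sub>R f (x + real j *\<^sub>R h))"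

definition polynomial_on ::
    "nat \<Rightarrow> 'a::real_vector set \<Rightarrow> ('a \<Rightarrow> 'b::real_vector) \<Rightarrow> bool" where
  "polynomial_on n D f \<longleftrightarrow>
     (\<forall>x\<in>D. \<forall>h. (\<forall>i\<in>{0..n+1}. x + real i *\<^sub>R h \<in> D) \<longrightarrow> fdiff (n+1) h f x = 0)"


text \<open>
  Independence of \<open>haar_meager\<close> from the type carrying the compact metric space.
\<close>

lemma inj_compact_metric_into_real:
  fixes K :: "'k metric"
  assumes "compact_space (mtopology_of K)"
  obtains h :: "'k \<Rightarrow> real" where "inj_on h (mspace K)"
proof -
  interpret Metric_space "mspace K" "mdist K" by simp
  have tb: "mtotally_bounded (mspace K)"
    using assms unfolding mtopology_of_def
    by (metis compact_space_def compactin_imp_mtotally_bounded topspace_mtopology)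
  have "\<exists>F. finite F \<and> F \<subseteq> mspace K \<and> mspace K \<subseteq> (\<Union>c\<in>F. mball c (1 / real (Suc n)))" for n
    using tb unfolding mtotally_bounded_def by (simp del: of_nat_Suc)
  then obtain F where F: "\<And>n. finite (F n)" "\<And>n. F n \<subseteq> mspace K"
      "\<And>n. mspace K \<subseteq> (\<Union>c\<in>F n. mball c (1 / real (Suc n)))"
    by metis
  define C where "C = (\<Union>n. F n)"
  have "countable C" unfolding C_def using F(1) by (simp add: countable_finite)
  then obtain e :: "'k \<Rightarrow> nat" where e: "inj_on e C" by (auto simp: countable_def)
  define G where "G x = {prod_encode (n, e c) |n c. c \<in> F n \<and> x \<in> mball c (1 / real (Suc n))}" for x
  have close: "mdist K x y < 2 / real (Suc n)"
    if xy: "x \<in> mspace K" "y \<in> mspace K" and eq: "G x = G y" for x y n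
  proof -
    obtain c where c: "c \<in> F n" "x \<in> mball c (1 / real (Suc n))" using F(3)[of n] xy by blast
    have "prod_encode (n, e c) \<in> G x" unfolding G_def using c by blast
    then have "prod_encode (n, e c) \<in> G y" by (simp only: eq)
    then obtain c' where c': "c' \<in> F n" "e c = e c'" "y \<in> mball c' (1 / real (Suc n))"
      unfolding G_def by (auto simp: prod_encode_eq simp del: of_nat_Suc)
    have "c = c'" using e c c' unfolding C_def inj_on_def by blast
    then have "mdist K c x < 1 / real (Suc n)" "mdist K c y < 1 / real (Suc n)" "c \<in> mspace K"
      using c c' by (auto simp del: of_nat_Suc)
    moreover have "mdist K x y \<le> mdist K c x + mdist K c y"
      using triangle''[of x c y] xy \<open>c \<in> mspace K\<close> by (simp add: commute)
    moreover have "2 / real (Suc n) = 1 / real (Suc n) + 1 / real (Suc n)"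
      by (simp del: of_nat_Suc)
    ultimately show ?thesis by linarith
  qed
  have injG: "inj_on G (mspace K)"
  proof (rule inj_onI, rule ccontr)
    fix x y assume xy: "x \<in> mspace K" "y \<in> mspace K" "G x = G y" "x \<noteq> y"
    then have pos: "mdist K x y / 2 > 0" by simp
    obtain n where "inverse (real (Suc n)) < mdist K x y / 2" using reals_Archimedean[OF pos] by blast
    with close[OF xy(1-3), of n] show False by (simp add: field_simps del: of_nat_Suc)
  qed
  obtain r :: "nat set \<Rightarrow> real" where r: "inj r"
    using nat_sets_eqpoll_reals by (auto simp: eqpoll_def bij_betw_def)
  have "inj_on (r \<circ> G) (mspace K)"
    using injG r by (auto simp: inj_on_def)
  then show ?thesis by (rule that)
qed

lemma meager_in_homeomorphic_image:
  assumes h: "homeomorphic_map S T h" and A: "meager_in S A"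
  shows "meager_in T (h ` A)"
proof -
  obtain \<F> where \<F>: "countable \<F>" "\<And>N. N \<in> \<F> \<Longrightarrow> nowhere_dense_in S N" "A = \<Union>\<F>"
    using A unfolding meager_in_def by blast
  have "nowhere_dense_in T (h ` N)" if "N \<in> \<F>" for N
  proof -
    have N: "N \<subseteq> topspace S" "S interior_of (S closure_of N) = {}"
      using \<F>(2)[OF that] by (auto simp: nowhere_dense_in_def)
    have "T interior_of (T closure_of (h ` N)) = h ` (S interior_of (S closure_of N))"
      using h N by (metis closure_of_subset_topspace homeomorphic_map_closure_of
          homeomorphic_map_interior_of)
    then show ?thesis
      using N homeomorphic_imp_surjective_map[OF h, symmetric]
      by (auto simp: nowhere_dense_in_def)
  qed
  then show ?thesis
    unfolding meager_in_def using \<F> by (intro exI[of _ "(`) h ` \<F>"]) auto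
qed

lemma haar_meager_witness_transfer:
  fixes K :: "'k metric" and g :: "'k \<Rightarrow> 'a::real_topological_vector"
  assumes w: "haar_meager_witness K g B"
  shows "\<exists>(L :: real metric) g'. haar_meager_witness L g' B"
proof -
  have cK: "compact_space (mtopology_of K)" and ne: "mspace K \<noteq> {}"
    and gK: "continuous_map (mtopology_of K) euclidean g"
    and mK: "\<And>x. meager_in (mtopology_of K) {k \<in> mspace K. g k \<in> (\<lambda>b. b + x) ` B}"
    using w by (auto simp: haar_meager_witness_def)
  obtain h :: "'k \<Rightarrow> real" where inj: "inj_on h (mspace K)"
    using inj_compact_metric_into_real[OF cK] .
  define i where "i = inv_into (mspace K) h"
  have ih: "i (h k) = k" if "k \<in> mspace K" for k using that inj by (simp add: i_def)
  define M where "M = h ` mspace K"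
  interpret K: Metric_space "mspace K" "mdist K" by simp
  have iM: "i u \<in> mspace K" "h (i u) = u" if "u \<in> M" for u
    using that by (auto simp: M_def ih)
  interpret L: Metric_space M "\<lambda>u v. mdist K (i u) (i v)"
  proof
    fix u v assume "u \<in> M" "v \<in> M"
    then show "mdist K (i u) (i v) = 0 \<longleftrightarrow> u = v" using iM by (metis K.zero)
  qed (auto simp: iM K.commute intro: K.triangle)
  define L where "L = metric (M, \<lambda>u v. mdist K (i u) (i v))"
  have L: "mspace L = M" "mdist L = (\<lambda>u v. mdist K (i u) (i v))"
    by (simp_all add: L_def)
  have "Lipschitz_continuous_map K L h"
    unfolding Lipschitz_continuous_map_def L by (auto simp: M_def ih intro!: exI[of _ 1])
  moreover have "Lipschitz_continuous_map L K i"
    unfolding Lipschitz_continuous_map_def L by (auto simp: iM intro!: exI[of _ 1])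
  ultimately have hom: "homeomorphic_maps (mtopology_of K) (mtopology_of L) h i"
    by (auto simp: homeomorphic_maps_def Lipschitz_continuous_imp_continuous_map L iM ih)
  have hm: "homeomorphic_map (mtopology_of K) (mtopology_of L) h"
    using hom homeomorphic_maps_map by blast
  have "meager_in (mtopology_of L) {u \<in> mspace L. (g \<circ> i) u \<in> (\<lambda>b. b + x) ` B}" for x
  proof -
    have "{u \<in> mspace L. (g \<circ> i) u \<in> (\<lambda>b. b + x) ` B}
        = h ` {k \<in> mspace K. g k \<in> (\<lambda>b. b + x) ` B}"
      unfolding L by (auto simp: M_def ih)
    then show ?thesis using meager_in_homeomorphic_image[OF hm mK] by simp
  qed
  moreover have "compact_space (mtopology_of L)"
    using cK hom homeomorphic_compact_space homeomorphic_space_def by blast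
  moreover have "continuous_map (mtopology_of L) euclidean (g \<circ> i)"
    using hom gK by (auto simp: homeomorphic_maps_def intro: continuous_map_compose)
  moreover have "mspace L \<noteq> {}"
    using ne by (simp add: L M_def)
  ultimately have "haar_meager_witness L (g \<circ> i) B"
    by (simp add: haar_meager_witness_def)
  then show ?thesis by blast
qed

lemma haar_meagerI:
  fixes K :: "'k metric"
  assumes "B \<in> sets borel" "A \<subseteq> B" "haar_meager_witness K g B"
  shows "haar_meager A"
  using assms haar_meager_witness_transfer[OF assms(3)] unfolding haar_meager_def by blast

end

theory Submission
  imports Defs "HOL-Computational_Algebra.Polynomial"
begin

text \<open>
  A measurable polynomial function is shown to be locally bounded, and a locally bounded polynomial
  function is shown to be continuous.  The target space carries no norm and need not be separable, so
  it cannot be covered by countably many small sets; but it is the union of the multiples \<open>m V\<close> of any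
  neighbourhood \<open>V\<close> of \<open>0\<close>, and boundedness of \<open>f\<close> relative to each \<open>V\<close> separately is all that is used.

  Boundedness implies continuity because a polynomial function can be interpolated
  (\<open>polynomial_on_interpolation\<close>): its increment over a short step \<open>h\<close> is a combination of its values
  at the points \<open>x, x + N h, \<dots>, x + n N h\<close>, with coefficients that tend to \<open>0\<close> for \<open>N \<rightarrow> \<infinity>\<close>.

  For local boundedness at \<open>p\<close>, let \<open>A\<^sub>m\<close> be the set where \<open>f\<close> takes values in \<open>m V\<close>.  These increasing
  sets cover the domain, and each is Borel up to a Haar meager set.  If \<open>f\<close> is unbounded near \<open>p\<close>, there
  are arbitrarily short vectors \<open>u\<^sub>i\<close> at which \<open>f (p + u\<^sub>i)\<close> lies outside a prescribed multiple of a
  larger neighbourhood.  The lemma \<open>ex_common_shift\<close>, an analogue of the theorems of Steinhaus and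
  Piccard, yields \<open>m\<close>, an index \<open>i \<ge> m\<close> and a vector \<open>h\<close> such that all the points
  \<open>p + u\<^sub>i + j h\<close> with \<open>1 \<le> j \<le> n + 1\<close> lie in \<open>A\<^sub>m\<close>.  Since \<open>\<Delta>\<^sub>h\<^sup>n\<^sup>+\<^sup>1 f (p + u\<^sub>i) = 0\<close>, the value \<open>f (p + u\<^sub>i)\<close>
  is a fixed linear combination of the values at these points, which confines it to the multiple that
  it was chosen to avoid.

  The proof of \<open>ex_common_shift\<close> sums the witnesses for all the exceptional Haar meager sets,
  together with the finite sets of multiples of the vectors \<open>u\<^sub>i\<close>, to one continuous map on a compact
  product space (\<open>ex_summable_pieces\<close>).  There the Baire category theorem and one half of the
  Kuratowski-Ulam theorem (\<open>meager_if_sections_meager\<close>) apply.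
\<close>

section \<open>Baire category in compact spaces and their products\<close>

lemma nowhere_dense_in_iff_closed_cover:
  "nowhere_dense_in T S \<longleftrightarrow> (\<exists>C. closedin T C \<and> T interior_of C = {} \<and> S \<subseteq> C)"
proof
  assume "nowhere_dense_in T S"
  then show "\<exists>C. closedin T C \<and> T interior_of C = {} \<and> S \<subseteq> C"
    unfolding nowhere_dense_in_def by (meson closedin_closure_of closure_of_subset)
next
  assume "\<exists>C. closedin T C \<and> T interior_of C = {} \<and> S \<subseteq> C"
  then obtain C where C: "closedin T C" "T interior_of C = {}" "S \<subseteq> C" by blast
  then have "T closure_of S \<subseteq> C" by (simp add: closure_of_minimal)
  then have "T interior_of (T closure_of S) = {}"
    using C(2) interior_of_mono[of _ C T] by blast
  then show "nowhere_dense_in T S"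
    using C closedin_subset unfolding nowhere_dense_in_def by blast
qed

lemma meager_in_iff_closed_cover:
  "meager_in T S \<longleftrightarrow>
     (\<exists>\<F>. countable \<F> \<and> (\<forall>C\<in>\<F>. closedin T C \<and> T interior_of C = {}) \<and> S \<subseteq> \<Union>\<F>)"
proof
  assume "meager_in T S"
  then obtain \<N> where \<N>: "countable \<N>" "\<forall>N\<in>\<N>. nowhere_dense_in T N" "S = \<Union>\<N>"
    unfolding meager_in_def by blast
  then obtain c where "\<forall>N\<in>\<N>. closedin T (c N) \<and> T interior_of c N = {} \<and> N \<subseteq> c N"
    unfolding nowhere_dense_in_iff_closed_cover by metis
  with \<N> show "\<exists>\<F>. countable \<F> \<and> (\<forall>C\<in>\<F>. closedin T C \<and> T interior_of C = {}) \<and> S \<subseteq> \<Union>\<F>"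
    by (intro exI[of _ "c ` \<N>"]) fastforce
next
  assume "\<exists>\<F>. countable \<F> \<and> (\<forall>C\<in>\<F>. closedin T C \<and> T interior_of C = {}) \<and> S \<subseteq> \<Union>\<F>"
  then obtain \<F> where \<F>: "countable \<F>" "\<forall>C\<in>\<F>. closedin T C \<and> T interior_of C = {}" "S \<subseteq> \<Union>\<F>"
    by blast
  have "nowhere_dense_in T (S \<inter> C)" if "C \<in> \<F>" for C
    using that \<F> unfolding nowhere_dense_in_iff_closed_cover by blast
  with \<F> show "meager_in T S"
    unfolding meager_in_def by (intro exI[of _ "(\<inter>) S ` \<F>"]) auto
qed

lemma meager_in_subset: "meager_in T S \<Longrightarrow> S' \<subseteq> S \<Longrightarrow> meager_in T S'"
  unfolding meager_in_iff_closed_cover by (meson order_trans)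

lemma meager_in_Union:
  assumes "countable \<A>" "\<And>S. S \<in> \<A> \<Longrightarrow> meager_in T S"
  shows "meager_in T (\<Union>\<A>)"
proof -
  obtain \<F> where \<F>: "\<And>S. S \<in> \<A> \<Longrightarrow> countable (\<F> S)"
      "\<And>S N. S \<in> \<A> \<Longrightarrow> N \<in> \<F> S \<Longrightarrow> nowhere_dense_in T N" "\<And>S. S \<in> \<A> \<Longrightarrow> S = \<Union>(\<F> S)"
    using assms(2) unfolding meager_in_def by metis
  have "\<Union>\<A> = \<Union>(\<Union>S\<in>\<A>. \<F> S)"
    (is "_ = ?R")
  proof
    show "\<Union>\<A> \<subseteq> ?R"
    proof
      fix x assume "x \<in> \<Union>\<A>"
      then obtain S where S: "S \<in> \<A>" "x \<in> S" by blast
      with \<F>(3)[of S] have "x \<in> \<Union>(\<F> S)" by simp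
      with S(1) show "x \<in> ?R" by blast
    qed
    show "?R \<subseteq> \<Union>\<A>"
    proof
      fix x assume "x \<in> ?R"
      then obtain S where S: "S \<in> \<A>" "x \<in> \<Union>(\<F> S)" by blast
      with \<F>(3)[of S] have "x \<in> S" by simp
      with S(1) show "x \<in> \<Union>\<A>" by blast
    qed
  qed
  moreover have "countable (\<Union>S\<in>\<A>. \<F> S)" using assms(1) \<F>(1) by (rule countable_UN)
  ultimately show ?thesis
    unfolding meager_in_def using \<F>(2) by (intro exI[of _ "\<Union>S\<in>\<A>. \<F> S"]) auto
qed

lemma meager_in_UN:
  "countable I \<Longrightarrow> (\<And>i. i \<in> I \<Longrightarrow> meager_in T (S i)) \<Longrightarrow> meager_in T (\<Union>i\<in>I. S i)"
  by (rule meager_in_Union) auto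

lemma meager_in_Un: "meager_in T A \<Longrightarrow> meager_in T B \<Longrightarrow> meager_in T (A \<union> B)"
  using meager_in_Union[of "{A, B}" T] by auto

lemma meager_in_empty: "meager_in T {}"
  unfolding meager_in_def by (intro exI[of _ "{}"]) auto

lemma Baire_point_avoiding:
  assumes T: "compact_space T" "Hausdorff_space T"
    and \<F>: "countable \<F>" "\<And>C. C \<in> \<F> \<Longrightarrow> closedin T C \<and> T interior_of C = {}"
    and U: "openin T U" "U \<noteq> {}"
  shows "\<exists>x\<in>U. x \<notin> \<Union>\<F>"
proof (rule ccontr)
  assume "\<not> ?thesis"
  then have "U \<subseteq> T interior_of \<Union>\<F>"
    using U(1) by (intro interior_of_maximal) auto
  moreover have "T interior_of \<Union>\<F> = {}"
    using T \<F> by (intro Baire_category_alt)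
      (auto simp: compact_imp_locally_compact_space compact_Hausdorff_imp_regular_space)
  ultimately show False using U(2) by blast
qed

lemma nonmeager_open:
  assumes "compact_space T" "Hausdorff_space T" "openin T U" "U \<noteq> {}"
  shows "\<not> meager_in T U"
  using Baire_point_avoiding[OF assms(1,2) _ _ assms(3,4)]
  unfolding meager_in_iff_closed_cover by (metis subsetD)

text \<open>
  Sets that agree with an open set up to a meager set.  Such a set is either meager or comeager in
  some nonempty open set, and this dichotomy is all that Borel measurability contributes to the
  proof.
\<close>

definition has_baire_property :: "'k topology \<Rightarrow> 'k set \<Rightarrow> bool" where
  "has_baire_property T S \<longleftrightarrow> (\<exists>U. openin T U \<and> meager_in T ((S - U) \<union> (U - S)))"

lemma has_baire_property_compl:
  assumes "has_baire_property T S"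
  shows "has_baire_property T (topspace T - S)"
proof -
  obtain U where U: "openin T U" "meager_in T ((S - U) \<union> (U - S))"
    using assms unfolding has_baire_property_def by blast
  \<comment> \<open>The complement of \<open>S\<close> agrees with the exterior of \<open>U\<close>; the boundary of \<open>U\<close> is the
    additional error.\<close>
  define B where "B = T closure_of U - U"
  have "T interior_of B = {}"
  proof (rule ccontr)
    assume "T interior_of B \<noteq> {}"
    then obtain V x where V: "openin T V" "V \<subseteq> B" "x \<in> V"
      unfolding interior_of_def by blast
    then have "x \<in> T closure_of U" by (auto simp: B_def)
    then obtain y where "y \<in> U" "y \<in> V" using V by (auto simp: in_closure_of)
    then show False using V by (auto simp: B_def)
  qed
  moreover have "closedin T B" using U(1) by (auto simp: B_def)
  ultimately have "meager_in T B"
    unfolding meager_in_iff_closed_cover by (intro exI[of _ "{B}"]) auto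
  with U(2) have "meager_in T (((S - U) \<union> (U - S)) \<union> B)" by (rule meager_in_Un)
  then have "meager_in T (((topspace T - S) - (topspace T - T closure_of U)) \<union>
      ((topspace T - T closure_of U) - (topspace T - S)))"
    by (rule meager_in_subset) (use closure_of_subset[OF openin_subset[OF U(1)]] in \<open>auto simp: B_def\<close>)
  then show ?thesis
    unfolding has_baire_property_def
    by (intro exI[of _ "topspace T - T closure_of U"]) auto
qed

lemma has_baire_property_UN:
  assumes "countable I" "\<And>i. i \<in> I \<Longrightarrow> has_baire_property T (S i)"
  shows "has_baire_property T (\<Union>i\<in>I. S i)"
proof -
  obtain U where U: "\<And>i. i \<in> I \<Longrightarrow> openin T (U i) \<and> meager_in T ((S i - U i) \<union> (U i - S i))"
    using assms(2) unfolding has_baire_property_def by metis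
  have "meager_in T (\<Union>i\<in>I. (S i - U i) \<union> (U i - S i))"
    using assms(1) U by (intro meager_in_UN) auto
  then have "meager_in T (((\<Union>i\<in>I. S i) - (\<Union>i\<in>I. U i)) \<union> ((\<Union>i\<in>I. U i) - (\<Union>i\<in>I. S i)))"
    by (rule meager_in_subset) auto
  then show ?thesis
    unfolding has_baire_property_def using U by (intro exI[of _ "\<Union>i\<in>I. U i"]) auto
qed

lemma has_baire_property_borel_preimage:
  fixes \<phi> :: "'k \<Rightarrow> 'a::topological_space"
  assumes \<phi>: "continuous_map T euclidean \<phi>" and S: "S \<in> sets borel"
  shows "has_baire_property T {k \<in> topspace T. \<phi> k \<in> S}"
proof -
  have "S \<in> sigma_sets UNIV {S. open S}"
    using S by (simp add: borel_def)
  then show ?thesis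
  proof induction
    case (Basic a)
    then have "openin T {k \<in> topspace T. \<phi> k \<in> a}"
      using \<phi> by (auto intro: openin_continuous_map_preimage)
    then show ?case
      unfolding has_baire_property_def
      by (intro exI[of _ "{k \<in> topspace T. \<phi> k \<in> a}"]) (simp add: meager_in_empty)
  next
    case Empty
    then show ?case
      unfolding has_baire_property_def by (intro exI[of _ "{}"]) (simp add: meager_in_empty)
  next
    case (Compl a)
    have "{k \<in> topspace T. \<phi> k \<in> UNIV - a} = topspace T - {k \<in> topspace T. \<phi> k \<in> a}" by auto
    with has_baire_property_compl[OF Compl.IH] show ?case by simp
  next
    case (Union a)
    have "{k \<in> topspace T. \<phi> k \<in> \<Union>(range a)} = (\<Union>n. {k \<in> topspace T. \<phi> k \<in> a n})" by auto
    moreover have "has_baire_property T (\<Union>n. {k \<in> topspace T. \<phi> k \<in> a n})"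
      using Union.IH by (intro has_baire_property_UN) auto
    ultimately show ?case by simp
  qed
qed

lemma continuous_map_fun_upd_const:
  assumes "t \<in> topspace (Ts i)"
  shows "continuous_map (product_topology Ts UNIV) (product_topology Ts UNIV) (\<lambda>y. y(i := t))"
  unfolding continuous_map_componentwise_UNIV
proof
  fix k
  show "continuous_map (product_topology Ts UNIV) (Ts k) (\<lambda>y. (y(i := t)) k)"
    using assms by (cases "k = i") (auto intro: continuous_map_product_projection)
qed

lemma continuous_map_fun_upd:
  assumes "y \<in> topspace (product_topology Ts UNIV)"
  shows "continuous_map (Ts i) (product_topology Ts UNIV) (\<lambda>t. y(i := t))"
  unfolding continuous_map_componentwise_UNIV
proof
  fix k
  show "continuous_map (Ts i) (Ts k) (\<lambda>t. (y(i := t)) k)"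
    using assms by (cases "k = i") auto
qed

lemma fun_upd_in_product:
  assumes "y \<in> topspace (product_topology Ts UNIV)" "t \<in> topspace (Ts i)"
  shows "y(i := t) \<in> topspace (product_topology Ts UNIV)"
  using assms by (auto simp: PiE_def)

text \<open>
  The engine for category arguments in products.  An open set \<open>P\<close> of points \<open>y\<close> whose fibres over \<open>W\<close>
  lie in \<open>F\<close> would produce an open subset of \<open>F\<close>: move the \<open>i\<close>-th coordinate of the points of \<open>P\<close>
  into \<open>W\<close>.  The lemma is used with \<open>W\<close> running through a countable base (Kuratowski and Ulam)
  and with \<open>W\<close> an isolated point (changing a coordinate of a generic point keeps it generic).
\<close>

lemma nowhere_dense_slice:
  fixes Ts :: "'i \<Rightarrow> 'k topology"
  defines "T \<equiv> product_topology Ts UNIV"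
  assumes F: "closedin T F" "T interior_of F = {}"
    and W: "openin (Ts i) W" "W \<noteq> {}"
  shows "closedin T {y \<in> topspace T. \<forall>t\<in>W. y(i := t) \<in> F} \<and>
         T interior_of {y \<in> topspace T. \<forall>t\<in>W. y(i := t) \<in> F} = {}" (is "closedin T ?S \<and> _")
proof
  have WT: "W \<subseteq> topspace (Ts i)" using W(1) by (rule openin_subset)
  have "?S = (\<Inter>t\<in>W. {y \<in> topspace T. y(i := t) \<in> F})" using W(2) by auto
  moreover have "closedin T {y \<in> topspace T. y(i := t) \<in> F}" if "t \<in> W" for t
    using that WT F(1) continuous_map_fun_upd_const[of t Ts i] unfolding T_def
    by (intro closedin_continuous_map_preimage) auto
  ultimately show "closedin T ?S" using W(2) by auto
  show "T interior_of ?S = {}"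
  proof (rule ccontr)
    assume "T interior_of ?S \<noteq> {}"
    then obtain P y where P: "openin T P" "P \<subseteq> ?S" "y \<in> P"
      unfolding interior_of_def by blast
    have yT: "y \<in> topspace T" using P openin_subset by blast
    then have yi: "y i \<in> topspace (Ts i)" by (auto simp: T_def)
    define P' where "P' = {z \<in> topspace T. z i \<in> W} \<inter> {z \<in> topspace T. z(i := y i) \<in> P}"
    have "openin T P'"
      unfolding P'_def
    proof (intro openin_Int)
      show "openin T {z \<in> topspace T. z i \<in> W}"
        using W(1) unfolding T_def
        by (intro openin_continuous_map_preimage[OF continuous_map_product_projection]) auto
      show "openin T {z \<in> topspace T. z(i := y i) \<in> P}"
        using continuous_map_fun_upd_const[of "y i" Ts i] yi P(1) unfolding T_def
        by (intro openin_continuous_map_preimage) auto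
    qed
    moreover have "P' \<subseteq> F"
    proof
      fix z assume z: "z \<in> P'"
      then have "z(i := y i) \<in> ?S" "z i \<in> W" using P by (auto simp: P'_def)
      then have "(z(i := y i))(i := z i) \<in> F" by blast
      then show "z \<in> F" by simp
    qed
    moreover obtain w where "w \<in> W" using W(2) by blast
    then have "y(i := w) \<in> P'"
      using P yT WT fun_upd_in_product[of y Ts w i] by (auto simp: P'_def T_def)
    ultimately show False using F(2) interior_of_maximal by blast
  qed
qed

text \<open>
  The converse half of the Kuratowski-Ulam theorem, for one coordinate of a product.  If \<open>E\<close> were not
  meager, it would be comeager in a nonempty open set \<open>U\<close>.  A generic \<open>y \<in> U\<close> lies in none of the
  slices of the countably many closed nowhere dense sets that cover the error, so each of those sets
  has a nowhere dense section at \<open>y\<close>.  Hence the section of \<open>U\<close> at \<open>y\<close>, a nonempty open set, would be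
  meager.
\<close>

lemma meager_if_sections_meager:
  fixes Ts :: "'i \<Rightarrow> 'k topology"
  defines "T \<equiv> product_topology Ts UNIV"
  assumes Ts: "\<And>l. compact_space (Ts l)" "\<And>l. Hausdorff_space (Ts l)"
    and i: "second_countable (Ts i)"
    and E: "has_baire_property T E"
    and sec: "\<And>y. y \<in> topspace T \<Longrightarrow> meager_in (Ts i) {t \<in> topspace (Ts i). y(i := t) \<in> E}"
  shows "meager_in T E"
proof -
  have T: "compact_space T" "Hausdorff_space T"
    using Ts by (auto simp: T_def compact_space_product_topology Hausdorff_space_product_topology)
  obtain U where U: "openin T U" "meager_in T ((E - U) \<union> (U - E))"
    using E unfolding has_baire_property_def by blast
  have "U = {}"
  proof (rule ccontr)
    assume "U \<noteq> {}"
    obtain \<F> where \<F>: "countable \<F>" "\<And>C. C \<in> \<F> \<Longrightarrow> closedin T C \<and> T interior_of C = {}"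
        "(E - U) \<union> (U - E) \<subseteq> \<Union>\<F>"
      using U(2) unfolding meager_in_iff_closed_cover by auto
    obtain \<B> where \<B>: "countable \<B>" "\<And>V. V \<in> \<B> \<Longrightarrow> openin (Ts i) V"
        "\<And>V x. openin (Ts i) V \<Longrightarrow> x \<in> V \<Longrightarrow> \<exists>W\<in>\<B>. x \<in> W \<and> W \<subseteq> V"
      using i unfolding second_countable_def by metis
    define slice where "slice = (\<lambda>(W, C). {y \<in> topspace T. \<forall>t\<in>W. y(i := t) \<in> C})"
    have "\<exists>y\<in>U. y \<notin> \<Union>(slice ` ((\<B> - {{}}) \<times> \<F>))"
    proof (rule Baire_point_avoiding[OF T _ _ U(1) \<open>U \<noteq> {}\<close>])
      show "countable (slice ` ((\<B> - {{}}) \<times> \<F>))" using \<B>(1) \<F>(1) by auto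
      show "closedin T C \<and> T interior_of C = {}" if C: "C \<in> slice ` ((\<B> - {{}}) \<times> \<F>)" for C
      proof -
        obtain W C' where "C = slice (W, C')" "W \<in> \<B>" "W \<noteq> {}" "C' \<in> \<F>" using C by auto
        then show ?thesis
          using nowhere_dense_slice[of Ts C' i W] \<B>(2)[of W] \<F>(2)[of C']
          unfolding slice_def T_def by simp
      qed
    qed
    then obtain y where y: "y \<in> U" "y \<notin> \<Union>(slice ` ((\<B> - {{}}) \<times> \<F>))" by (rule bexE)
    have yT: "y \<in> topspace T" using y U(1) openin_subset by blast
    have cont: "continuous_map (Ts i) T (\<lambda>t. y(i := t))"
      using continuous_map_fun_upd[of y Ts i] yT unfolding T_def by simp
    define V where "V = {t \<in> topspace (Ts i). y(i := t) \<in> U}"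
    have V: "openin (Ts i) V"
      unfolding V_def using cont U(1) by (rule openin_continuous_map_preimage)
    have "y i \<in> V" using y yT by (auto simp: V_def T_def)
    define s where "s C = {t \<in> topspace (Ts i). y(i := t) \<in> C}" for C
    have "meager_in (Ts i) (\<Union>C\<in>\<F>. s C)"
    proof -
      have "closedin (Ts i) (s C)" if "C \<in> \<F>" for C
        unfolding s_def using cont \<F>(2)[OF that] by (auto intro: closedin_continuous_map_preimage)
      moreover have "Ts i interior_of (s C) = {}" if "C \<in> \<F>" for C
      proof (rule ccontr)
        assume "Ts i interior_of (s C) \<noteq> {}"
        then obtain P x where P: "openin (Ts i) P" "P \<subseteq> s C" "x \<in> P"
          unfolding interior_of_def by blast
        then obtain W where W: "W \<in> \<B>" "x \<in> W" "W \<subseteq> P" using \<B>(3)[OF P(1,3)] by blast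
        then have "y \<in> slice (W, C)" using P yT by (auto simp: slice_def s_def)
        moreover have "(W, C) \<in> (\<B> - {{}}) \<times> \<F>" using W that by auto
        ultimately show False using y(2) by auto
      qed
      ultimately show ?thesis
        unfolding meager_in_iff_closed_cover using \<F>(1) by (intro exI[of _ "s ` \<F>"]) auto
    qed
    then have "meager_in (Ts i) ({t \<in> topspace (Ts i). y(i := t) \<in> E} \<union> (\<Union>C\<in>\<F>. s C))"
      using sec[OF yT] by (intro meager_in_Un)
    then have "meager_in (Ts i) V"
      by (rule meager_in_subset) (use \<F>(3) in \<open>auto simp: V_def s_def\<close>)
    then show False using nonmeager_open[OF Ts(1,2) V] \<open>y i \<in> V\<close> by blast
  qed
  then show ?thesis using U(2) by simp
qed

lemma compact_metric_second_countable:
  assumes "compact_space (mtopology_of K)"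
  shows "second_countable (mtopology_of K)"
proof -
  interpret Metric_space "mspace K" "mdist K" by simp
  have tb: "mtotally_bounded (mspace K)"
    using assms unfolding mtopology_of_def
    by (metis compact_space_def compactin_imp_mtotally_bounded topspace_mtopology)
  have "\<exists>F. finite F \<and> F \<subseteq> mspace K \<and> mspace K \<subseteq> (\<Union>c\<in>F. mball c (1 / real (Suc n)))" for n
    using tb unfolding mtotally_bounded_def by (simp del: of_nat_Suc)
  then obtain F where F: "\<And>n. finite (F n)" "\<And>n. F n \<subseteq> mspace K"
      "\<And>n. mspace K \<subseteq> (\<Union>c\<in>F n. mball c (1 / real (Suc n)))"
    by metis
  define \<B> where "\<B> = (\<Union>n. (\<lambda>c. mball c (1 / real (Suc n))) ` F n)"
  show ?thesis
    unfolding second_countable_def mtopology_of_def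
  proof (intro exI[of _ \<B>] conjI allI impI)
    show "countable \<B>" unfolding \<B>_def using F(1) by (simp add: countable_finite)
    show "\<forall>V\<in>\<B>. openin mtopology V" unfolding \<B>_def by auto
    fix U x assume "openin mtopology U \<and> x \<in> U"
    then obtain r where r: "r > 0" "mball x r \<subseteq> U" "x \<in> mspace K"
      unfolding openin_mtopology by blast
    obtain n where n: "inverse (real (Suc n)) < r / 2"
      using reals_Archimedean[of "r/2"] r by auto
    obtain c where c: "c \<in> F n" "x \<in> mball c (1 / real (Suc n))" using F(3)[of n] r by blast
    have "mball c (1 / real (Suc n)) \<subseteq> mball x r"
    proof
      fix z assume z: "z \<in> mball c (1 / real (Suc n))"
      have "mdist K x z \<le> mdist K c x + mdist K c z"
        using triangle''[of x c z] c z r(3) by (auto simp: commute)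
      also have "\<dots> < r" using c z n by (auto simp: inverse_eq_divide simp del: of_nat_Suc)
      finally show "z \<in> mball x r" using z r by auto
    qed
    then show "\<exists>V\<in>\<B>. x \<in> V \<and> V \<subseteq> U" using c r unfolding \<B>_def by blast
  qed
qed

text \<open>
  Meagerness does not pass to arbitrary closed subspaces.  It passes to the closure of an open set,
  because every relatively open subset of the closure meets the open set itself.  This allows a
  witness of Haar meagerness to be cut down to a compact piece whose image is small.
\<close>

lemma meager_in_closure_of_open_subspace:
  assumes M: "meager_in T M" and U: "openin T U"
  defines "L \<equiv> T closure_of U"
  shows "meager_in (subtopology T L) (M \<inter> L)"
proof -
  obtain \<F> where \<F>: "countable \<F>" "\<And>C. C \<in> \<F> \<Longrightarrow> closedin T C \<and> T interior_of C = {}" "M \<subseteq> \<Union>\<F>"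
    using M unfolding meager_in_iff_closed_cover by blast
  have "subtopology T L interior_of (L \<inter> C) = {}" if "C \<in> \<F>" for C
  proof (rule ccontr)
    assume "subtopology T L interior_of (L \<inter> C) \<noteq> {}"
    then obtain P x where P: "openin T P" "P \<inter> L \<subseteq> L \<inter> C" "x \<in> P" "x \<in> L"
      unfolding interior_of_def openin_subtopology by blast
    then obtain z where "z \<in> U \<inter> P" by (auto simp: L_def in_closure_of)
    moreover have "U \<inter> P \<subseteq> C"
      using P closure_of_subset[OF openin_subset[OF U]] by (auto simp: L_def)
    moreover have "openin T (U \<inter> P)" using U P by blast
    ultimately show False using \<F>(2)[OF that] interior_of_maximal by blast
  qed
  moreover have "closedin (subtopology T L) (L \<inter> C)" if "C \<in> \<F>" for C
    using \<F>(2)[OF that] closedin_subtopology_Int_closed by blast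
  ultimately show ?thesis
    unfolding meager_in_iff_closed_cover using \<F>(1,3)
    by (intro exI[of _ "(\<inter>) L ` \<F>"]) auto
qed

section \<open>Neighbourhoods of zero in topological vector spaces\<close>

lemma tendsto_scaleR_tvs:
  fixes g :: "'k \<Rightarrow> 'a::real_topological_vector"
  assumes "(c \<longlongrightarrow> c0) F" "(g \<longlongrightarrow> g0) F"
  shows "((\<lambda>x. c x *\<^sub>R g x) \<longlongrightarrow> c0 *\<^sub>R g0) F"
  using filterlim_compose[OF tendsto_scaleR_Pair filterlim_Pair[OF assms]] by simp

lemma continuous_on_scaleR_tvs [continuous_intros]:
  fixes g :: "'k::topological_space \<Rightarrow> 'a::real_topological_vector"
  shows "continuous_on S c \<Longrightarrow> continuous_on S g \<Longrightarrow> continuous_on S (\<lambda>x. c x *\<^sub>R g x)"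
  unfolding continuous_on_def by (blast intro: tendsto_scaleR_tvs)

definition balanced_nhd :: "'a::real_topological_vector set \<Rightarrow> bool" where
  "balanced_nhd V \<longleftrightarrow> open V \<and> 0 \<in> V \<and> (\<forall>c v. \<bar>c\<bar> \<le> 1 \<longrightarrow> v \<in> V \<longrightarrow> c *\<^sub>R v \<in> V)"

lemma balanced_nhdD:
  assumes "balanced_nhd V"
  shows "open V" "0 \<in> V" "\<bar>c\<bar> \<le> 1 \<Longrightarrow> v \<in> V \<Longrightarrow> c *\<^sub>R v \<in> V"
  using assms by (auto simp: balanced_nhd_def)

lemma balanced_nhd_Int: "balanced_nhd V \<Longrightarrow> balanced_nhd W \<Longrightarrow> balanced_nhd (V \<inter> W)"
  by (auto simp: balanced_nhd_def)

lemma open_scaled: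
  fixes V :: "'a::real_topological_vector set"
  assumes "open V"
  shows "open {v. c *\<^sub>R v \<in> V}"
proof -
  have "continuous_on UNIV (\<lambda>v::'a. c *\<^sub>R v)" by (intro continuous_intros)
  from open_vimage[OF assms this] show ?thesis by (simp add: vimage_def)
qed

lemma ex_balanced_nhd:
  fixes U :: "'a::real_topological_vector set"
  assumes "open U" "0 \<in> U"
  obtains V where "balanced_nhd V" "V \<subseteq> U"
proof -
  have "LIM p (nhds 0 \<times>\<^sub>F nhds (0::'a)). fst p *\<^sub>R snd p :> nhds 0"
    using tendsto_scaleR_Pair[of 0 "0::'a"] by simp
  then have "eventually (\<lambda>p. fst p *\<^sub>R snd p \<in> U) (nhds (0::real) \<times>\<^sub>F nhds (0::'a))"
    using assms unfolding filterlim_iff by (meson eventually_nhds)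
  then obtain P Q where PQ: "eventually P (nhds (0::real))" "eventually Q (nhds (0::'a))"
      "\<And>c v. P c \<Longrightarrow> Q v \<Longrightarrow> c *\<^sub>R v \<in> U"
    unfolding eventually_prod_filter by auto
  obtain d where d: "d > 0" "\<And>c. \<bar>c\<bar> < d \<Longrightarrow> P c"
    using PQ(1) unfolding eventually_nhds_metric by (auto simp: dist_real_def)
  obtain V0 where V0: "open V0" "0 \<in> V0" "\<And>v. v \<in> V0 \<Longrightarrow> Q v"
    using PQ(2) unfolding eventually_nhds by blast
  define V where "V = (\<Union>c\<in>{c. 0 < \<bar>c\<bar> \<and> \<bar>c\<bar> < d}. {v. (1 / c) *\<^sub>R v \<in> V0})"
  have "V \<subseteq> U"
  proof
    fix v assume "v \<in> V"
    then obtain c where c: "0 < \<bar>c\<bar>" "\<bar>c\<bar> < d" "(1 / c) *\<^sub>R v \<in> V0" by (auto simp: V_def)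
    then have "c *\<^sub>R ((1 / c) *\<^sub>R v) \<in> U" using d V0 PQ(3) by blast
    then show "v \<in> U" using c by simp
  qed
  moreover have "balanced_nhd V"
    unfolding balanced_nhd_def
  proof (intro conjI allI impI)
    show "open V" unfolding V_def using V0(1) by (intro open_UN ballI open_scaled)
    show zero: "0 \<in> V" unfolding V_def using d(1) V0(2) by (auto intro!: exI[of _ "d / 2"])
    fix a :: real and v assume a: "\<bar>a\<bar> \<le> 1" and "v \<in> V"
    then obtain c where c: "0 < \<bar>c\<bar>" "\<bar>c\<bar> < d" "(1 / c) *\<^sub>R v \<in> V0" by (auto simp: V_def)
    show "a *\<^sub>R v \<in> V"
    proof (cases "a = 0")
      case True
      then show ?thesis using zero by simp
    next
      case False
      have "\<bar>a * c\<bar> \<le> \<bar>c\<bar>" using a by (simp add: abs_mult mult_left_le_one_le)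
      then have "0 < \<bar>a * c\<bar>" "\<bar>a * c\<bar> < d" using c False by auto
      moreover have "(1 / (a * c)) *\<^sub>R (a *\<^sub>R v) \<in> V0" using c False by simp
      ultimately show ?thesis unfolding V_def by blast
    qed
  qed
  ultimately show ?thesis using that by blast
qed

text \<open>
  Iterated continuity of addition and scaling at the origin.  It takes the place of a seminorm: a
  fixed linear combination of vectors that are small of order \<open>V\<close> is small of order \<open>U\<close>.
\<close>

lemma ex_balanced_nhd_combination:
  fixes U :: "'a::real_topological_vector set"
  assumes "finite J" "open U" "0 \<in> U"
  shows "\<exists>V. balanced_nhd V \<and> (\<forall>y. (\<forall>j\<in>J. y j \<in> V) \<longrightarrow> (\<Sum>j\<in>J. a j *\<^sub>R y j) \<in> U)"
  using assms
proof (induction J arbitrary: U rule: finite_induct)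
  case empty
  then show ?case using ex_balanced_nhd[of U] by auto
next
  case (insert k J)
  have "((\<lambda>p. a k *\<^sub>R fst p + snd p) \<longlongrightarrow> a k *\<^sub>R 0 + 0) (nhds (0::'a) \<times>\<^sub>F nhds (0::'a))"
    by (intro tendsto_add tendsto_scaleR_tvs tendsto_const filterlim_fst filterlim_snd)
  then have "eventually (\<lambda>p. a k *\<^sub>R fst p + snd p \<in> U) (nhds (0::'a) \<times>\<^sub>F nhds (0::'a))"
    using insert.prems by (auto simp: tendsto_def)
  then obtain P Q where PQ: "eventually P (nhds (0::'a))" "eventually Q (nhds (0::'a))"
      "\<And>v w. P v \<Longrightarrow> Q w \<Longrightarrow> a k *\<^sub>R v + w \<in> U"
    unfolding eventually_prod_filter by auto
  obtain A where A: "open A" "0 \<in> A" "\<And>v. v \<in> A \<Longrightarrow> P v" using PQ(1) unfolding eventually_nhds by blast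
  obtain B where B: "open B" "0 \<in> B" "\<And>v. v \<in> B \<Longrightarrow> Q v" using PQ(2) unfolding eventually_nhds by blast
  obtain V1 where V1: "balanced_nhd V1" "V1 \<subseteq> A" using ex_balanced_nhd[OF A(1,2)] .
  obtain V2 where V2: "balanced_nhd V2" "\<And>y. (\<forall>j\<in>J. y j \<in> V2) \<Longrightarrow> (\<Sum>j\<in>J. a j *\<^sub>R y j) \<in> B"
    using insert.IH[OF B(1,2)] by blast
  have "(\<Sum>j\<in>insert k J. a j *\<^sub>R y j) \<in> U" if "\<forall>j\<in>insert k J. y j \<in> V1 \<inter> V2" for y
  proof -
    have "a k *\<^sub>R y k + (\<Sum>j\<in>J. a j *\<^sub>R y j) \<in> U"
      using that V1 V2(2) A(3) B(3) by (intro PQ(3)) auto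
    then show ?thesis using insert.hyps by simp
  qed
  then show ?case using balanced_nhd_Int[OF V1(1) V2(1)] by blast
qed

lemma balanced_nhd_absorbs:
  assumes "balanced_nhd V"
  shows "\<exists>m::nat. (1 / real (Suc m)) *\<^sub>R y \<in> V"
proof -
  have "(\<lambda>m. (1 / real (Suc m)) *\<^sub>R y) \<longlonglongrightarrow> 0 *\<^sub>R y"
    using LIMSEQ_inverse_real_of_nat by (intro tendsto_scaleR_tvs tendsto_const) (simp add: inverse_eq_divide)
  then have "eventually (\<lambda>m. (1 / real (Suc m)) *\<^sub>R y \<in> V) sequentially"
    using balanced_nhdD[OF assms] unfolding tendsto_def by auto
  then show ?thesis by (rule eventually_happens'[OF sequentially_bot])
qed

lemma balanced_nhd_scale_mono:
  assumes "balanced_nhd V" "(1 / c) *\<^sub>R y \<in> V" "0 < c" "c \<le> d"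
  shows "(1 / d) *\<^sub>R y \<in> V"
proof -
  have "(c / d) *\<^sub>R ((1 / c) *\<^sub>R y) \<in> V"
    using assms(3,4) by (intro balanced_nhdD(3)[OF assms(1) _ assms(2)]) auto
  then show ?thesis using assms by simp
qed

section \<open>Locally bounded polynomial functions are continuous\<close>

lemma fdiff_Suc: "fdiff (Suc m) h f x = fdiff m h f (x + h) - fdiff m h f x"
proof -
  define F where "F j = f (x + real j *\<^sub>R h)" for j
  have F: "f (x + h + real j *\<^sub>R h) = F (Suc j)" for j
    by (simp add: F_def algebra_simps)
  have "fdiff (Suc m) h f x = (-1) ^ Suc m *\<^sub>R F 0 +
      (\<Sum>j=0..m. ((-1) ^ (m - j) * real ((m choose j) + (m choose Suc j))) *\<^sub>R F (Suc j))"
    unfolding fdiff_def F_def[symmetric]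
    by (subst sum.atLeast0_atMost_Suc_shift) simp
  also have "\<dots> = (\<Sum>j=0..m. ((-1) ^ (m - j) * real (m choose j)) *\<^sub>R F (Suc j)) +
      ((-1) ^ Suc m *\<^sub>R F 0 + (\<Sum>j=0..m. ((-1) ^ (m - j) * real (m choose Suc j)) *\<^sub>R F (Suc j)))"
    by (simp add: distrib_left scaleR_left_distrib sum.distrib)
  also have "(-1) ^ Suc m *\<^sub>R F 0 + (\<Sum>j=0..m. ((-1) ^ (m - j) * real (m choose Suc j)) *\<^sub>R F (Suc j))
      = - (\<Sum>j=0..Suc m. ((-1) ^ (m - j) * real (m choose j)) *\<^sub>R F j)"
  proof -
    have "((-1) ^ (m - j) * real (m choose Suc j)) *\<^sub>R F (Suc j) =
        - (((-1) ^ (m - Suc j) * real (m choose Suc j)) *\<^sub>R F (Suc j))" if "j \<le> m" for j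
    proof (cases "j = m")
      case False
      then have "m - j = Suc (m - Suc j)" using that by simp
      then show ?thesis by simp
    qed (simp add: binomial_eq_0)
    then show ?thesis
      by (subst sum.atLeast0_atMost_Suc_shift) (simp add: sum_negf)
  qed
  also have "(\<Sum>j=0..Suc m. ((-1) ^ (m - j) * real (m choose j)) *\<^sub>R F j) = fdiff m h f x"
    by (simp add: fdiff_def F_def)
  also have "(\<Sum>j=0..m. ((-1) ^ (m - j) * real (m choose j)) *\<^sub>R F (Suc j)) = fdiff m h f (x + h)"
    by (simp add: fdiff_def F)
  finally show ?thesis by simp
qed

text \<open>
  The operator identity \<open>(1 + \<Delta>)\<^sup>r = \<Sum>\<^sub>j (r choose j) \<Delta>\<^sup>j\<close>.
\<close>

lemma newton_forward:
  "f (x + real r *\<^sub>R h) = (\<Sum>j\<le>r. real (r choose j) *\<^sub>R fdiff j h f x)"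
proof (induction r arbitrary: x)
  case 0
  then show ?case by (simp add: fdiff_def)
next
  case (Suc r)
  have "f (x + real (Suc r) *\<^sub>R h) = f ((x + h) + real r *\<^sub>R h)"
    by (simp add: algebra_simps)
  also have "\<dots> = (\<Sum>j\<le>r. real (r choose j) *\<^sub>R fdiff j h f x)
      + (\<Sum>j\<le>r. real (r choose j) *\<^sub>R fdiff (Suc j) h f x)"
    unfolding Suc.IH sum.distrib[symmetric]
    by (rule sum.cong) (simp_all add: fdiff_Suc flip: scaleR_right_distrib)
  also have "(\<Sum>j\<le>r. real (r choose j) *\<^sub>R fdiff j h f x) =
      (\<Sum>j\<le>Suc r. real (r choose j) *\<^sub>R fdiff j h f x)"
    by simp
  also have "\<dots> = fdiff 0 h f x + (\<Sum>j\<le>r. real (r choose Suc j) *\<^sub>R fdiff (Suc j) h f x)"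
    by (subst sum.atMost_Suc_shift) simp
  finally show ?case
    by (subst sum.atMost_Suc_shift)
      (simp add: add.assoc scaleR_left_distrib sum.distrib del: sum.atMost_Suc)
qed

lemma polynomial_on_higher_fdiff:
  assumes "polynomial_on n D f" "n < m" "\<And>k. k \<le> m \<Longrightarrow> x + real k *\<^sub>R h \<in> D"
  shows "fdiff m h f x = 0"
  using assms(2,3)
proof (induction m arbitrary: x)
  case (Suc m)
  show ?case
  proof (cases "m = n")
    case True
    have "x \<in> D" using Suc.prems(2)[of 0] by simp
    moreover have "\<forall>i\<in>{0..n+1}. x + real i *\<^sub>R h \<in> D" using Suc.prems(2) True by simp
    ultimately show ?thesis using assms(1) True unfolding polynomial_on_def by simp
  next
    case False
    have "x + h + real k *\<^sub>R h \<in> D" if "k \<le> m" for k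
      using Suc.prems(2)[of "Suc k"] that by (simp add: algebra_simps)
    then have "fdiff m h f (x + h) = 0" using False Suc.prems(1) by (intro Suc.IH) auto
    moreover have "fdiff m h f x = 0" using False Suc.prems by (intro Suc.IH) auto
    ultimately show ?thesis by (simp add: fdiff_Suc)
  qed
qed simp

lemma polynomial_on_newton:
  assumes "polynomial_on n D f" "\<And>k. k \<le> r \<Longrightarrow> x + real k *\<^sub>R h \<in> D"
  shows "f (x + real r *\<^sub>R h) = (\<Sum>j\<le>n. real (r choose j) *\<^sub>R fdiff j h f x)"
proof -
  have "fdiff j h f x = 0" if "j \<le> r" "n < j" for j
    using that assms(2) by (intro polynomial_on_higher_fdiff[OF assms(1)]) auto
  then have "(\<Sum>j\<le>r. real (r choose j) *\<^sub>R fdiff j h f x) =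
      (\<Sum>j\<in>{..r} \<inter> {..n}. real (r choose j) *\<^sub>R fdiff j h f x)"
    by (intro sum.mono_neutral_right) (auto intro: leI)
  also have "\<dots> = (\<Sum>j\<le>n. real (r choose j) *\<^sub>R fdiff j h f x)"
    by (intro sum.mono_neutral_left) auto
  finally show ?thesis by (simp add: newton_forward)
qed

definition lagrange_basis :: "nat \<Rightarrow> nat \<Rightarrow> real poly" where
  "lagrange_basis n i = (\<Prod>l\<in>{..n} - {i}. smult (1 / (real i - real l)) [:- real l, 1:])"

lemma poly_lagrange_basis:
  assumes "i \<le> n" "k \<le> n"
  shows "poly (lagrange_basis n i) (real k) = (if k = i then 1 else 0)"
proof (cases "k = i")
  case True
  have "(\<Prod>l\<in>{..n} - {i}. poly (smult (1 / (real i - real l)) [:- real l, 1:]) (real i)) = 1"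
    by (rule prod.neutral) (auto simp: diff_divide_distrib[symmetric])
  then show ?thesis using True by (simp add: lagrange_basis_def poly_prod del: poly_smult poly_pCons)
next
  case False
  then have "k \<in> {..n} - {i}" using assms by simp
  then have "(\<Prod>l\<in>{..n} - {i}. poly (smult (1 / (real i - real l)) [:- real l, 1:]) (real k)) = 0"
    by (intro prod_zero) auto
  then show ?thesis using False by (simp only: lagrange_basis_def poly_prod if_False)
qed

lemma degree_lagrange_basis: "i \<le> n \<Longrightarrow> degree (lagrange_basis n i) \<le> n"
proof -
  assume i: "i \<le> n"
  have "degree (lagrange_basis n i)
      \<le> (\<Sum>l\<in>{..n} - {i}. degree (smult (1 / (real i - real l)) [:- real l, 1:]))"
    unfolding lagrange_basis_def by (rule order_trans[OF degree_prod_sum_le]) auto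
  also have "\<dots> \<le> (\<Sum>l\<in>{..n} - {i}. 1)" by (intro sum_mono) simp
  also have "\<dots> = n" using i by simp
  finally show ?thesis .
qed

text \<open>
  The difference of the two sides has degree at most \<open>n\<close> and the \<open>n + 1\<close> roots \<open>0, \<dots>, n\<close>.
\<close>

lemma lagrange_interpolation:
  assumes "degree p \<le> n"
  shows "poly p t = (\<Sum>i\<le>n. poly p (real i) * poly (lagrange_basis n i) t)"
proof -
  define d where "d = p - (\<Sum>i\<le>n. smult (poly p (real i)) (lagrange_basis n i))"
  have "d = 0"
  proof (rule ccontr)
    assume "d \<noteq> 0"
    have "poly d (real k) = 0" if "k \<le> n" for k
    proof -
      have "(\<Sum>i\<le>n. poly p (real i) * poly (lagrange_basis n i) (real k)) =
          (\<Sum>i\<le>n. if i = k then poly p (real k) else 0)"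
        using that by (intro sum.cong) (auto simp: poly_lagrange_basis)
      also have "\<dots> = poly p (real k)" using that by simp
      finally show ?thesis by (simp add: d_def poly_sum)
    qed
    then have "real ` {..n} \<subseteq> {x. poly d x = 0}" by auto
    then have "card (real ` {..n}) \<le> card {x. poly d x = 0}"
      using poly_roots_finite[OF \<open>d \<noteq> 0\<close>] by (rule card_mono[rotated])
    also have "\<dots> \<le> degree d" using \<open>d \<noteq> 0\<close> by (rule card_poly_roots_bound)
    also have "\<dots> \<le> n"
      unfolding d_def using assms degree_lagrange_basis
      by (intro degree_diff_le degree_sum_le) (auto intro: order_trans[OF degree_smult_le])
    finally show False by (simp add: card_image inj_on_def)
  qed
  then have "poly d t = 0" by simp
  then show ?thesis by (simp add: d_def poly_sum)
qed

lemma binomial_interpolation: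
  assumes "j \<le> n" "N \<ge> 1"
  shows "real (r choose j) =
    (\<Sum>i\<le>n. poly (lagrange_basis n i) (real r / real N) * real ((i * N) choose j))"
proof -
  \<comment> \<open>\<open>p x = (N x choose j)\<close>, interpolated at \<open>0, \<dots>, n\<close> and evaluated at \<open>r / N\<close>\<close>
  define p where "p = smult (1 / fact j) (\<Prod>l=0..<j. [:- real l, real N:])"
  have p: "poly p x = (real N * x) gchoose j" for x
    by (simp add: p_def gbinomial_prod_rev poly_prod algebra_simps)
  have "degree p \<le> (\<Sum>l=0..<j. degree [:- real l, real N:])"
    unfolding p_def by (intro order_trans[OF degree_smult_le] order_trans[OF degree_prod_sum_le]) auto
  also have "\<dots> \<le> (\<Sum>l=0..<j. 1)" by (intro sum_mono) simp
  also have "\<dots> \<le> n" using assms by simp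
  finally have "poly p (real r / real N) =
      (\<Sum>i\<le>n. poly p (real i) * poly (lagrange_basis n i) (real r / real N))"
    by (rule lagrange_interpolation)
  moreover have "poly p (real r / real N) = real (r choose j)"
    using assms(2) unfolding p by (simp add: binomial_gbinomial)
  moreover have "poly p (real i) = real ((i * N) choose j)" for i
    unfolding p binomial_gbinomial by (simp add: mult.commute)
  ultimately show ?thesis by (simp add: mult.commute)
qed

text \<open>
  Along an arithmetic progression \<open>f\<close> is a polynomial of degree at most \<open>n\<close> with vector coefficients,
  so its values with a small step \<open>h\<close> are determined by its values at \<open>n + 1\<close> widely spaced points.  By
  Newton's formula it is enough to interpolate the scalar functions \<open>r choose j\<close>.
\<close>

lemma polynomial_on_interpolation:
  assumes f: "polynomial_on n D f" and N: "N \<ge> 1"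
    and D: "\<And>k. k \<le> max r (n * N) \<Longrightarrow> x + real k *\<^sub>R h \<in> D"
  shows "f (x + real r *\<^sub>R h) =
    (\<Sum>i\<le>n. poly (lagrange_basis n i) (real r / real N) *\<^sub>R f (x + real (i * N) *\<^sub>R h))"
proof -
  have "f (x + real r *\<^sub>R h) = (\<Sum>j\<le>n. real (r choose j) *\<^sub>R fdiff j h f x)"
    using D by (intro polynomial_on_newton[OF f]) auto
  also have "\<dots> = (\<Sum>j\<le>n. \<Sum>i\<le>n. poly (lagrange_basis n i) (real r / real N) *\<^sub>R
      (real ((i * N) choose j) *\<^sub>R fdiff j h f x))"
  proof (rule sum.cong[OF refl])
    fix j assume "j \<in> {..n}"
    then have "real (r choose j) =
        (\<Sum>i\<le>n. poly (lagrange_basis n i) (real r / real N) * real ((i * N) choose j))"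
      using N by (intro binomial_interpolation) auto
    then show "real (r choose j) *\<^sub>R fdiff j h f x =
        (\<Sum>i\<le>n. poly (lagrange_basis n i) (real r / real N) *\<^sub>R (real ((i * N) choose j) *\<^sub>R fdiff j h f x))"
      by (simp only: scaleR_sum_left scaleR_scaleR)
  qed
  also have "\<dots> = (\<Sum>i\<le>n. \<Sum>j\<le>n. poly (lagrange_basis n i) (real r / real N) *\<^sub>R
      (real ((i * N) choose j) *\<^sub>R fdiff j h f x))"
    by (rule sum.swap)
  also have "\<dots> = (\<Sum>i\<le>n. poly (lagrange_basis n i) (real r / real N) *\<^sub>R f (x + real (i * N) *\<^sub>R h))"
  proof (rule sum.cong[OF refl])
    fix i assume "i \<in> {..n}"
    then have "i * N \<le> n * N" by simp
    then have "x + real k *\<^sub>R h \<in> D" if "k \<le> i * N" for k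
      using that by (intro D) linarith
    then have "f (x + real (i * N) *\<^sub>R h) = (\<Sum>j\<le>n. real ((i * N) choose j) *\<^sub>R fdiff j h f x)"
      by (rule polynomial_on_newton[OF f])
    then show "(\<Sum>j\<le>n. poly (lagrange_basis n i) (real r / real N) *\<^sub>R
        (real ((i * N) choose j) *\<^sub>R fdiff j h f x)) =
        poly (lagrange_basis n i) (real r / real N) *\<^sub>R f (x + real (i * N) *\<^sub>R h)"
      by (simp only: scaleR_sum_right)
  qed
  finally show ?thesis .
qed

text \<open>
  Boundedness in the sense of topological vector spaces, but with the neighbourhood \<open>W\<close> and the
  factor \<open>c\<close> both allowed to depend on the test neighbourhood \<open>U\<close>.
\<close>

definition locally_bounded_at :: "'a::real_topological_vector set \<Rightarrow> ('a \<Rightarrow> 'b::real_topological_vector) \<Rightarrow> 'a \<Rightarrow> bool" where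
  "locally_bounded_at D f x \<longleftrightarrow> (\<forall>U. balanced_nhd U \<longrightarrow>
     (\<exists>W c. open W \<and> 0 \<in> W \<and> c > 0 \<and> (\<forall>w\<in>W. x + w \<in> D \<longrightarrow> (1 / c) *\<^sub>R f (x + w) \<in> U)))"

text \<open>
  By interpolation, the increment \<open>f (x + h) - f x\<close> is \<open>\<Sum>\<^sub>i (L\<^sub>i(1/N) - L\<^sub>i(0)) f (x + i N h)\<close> with fixed
  polynomials \<open>L\<^sub>i\<close>.  The coefficients tend to \<open>0\<close> as \<open>N\<close> grows, while the values \<open>f (x + i N h)\<close> stay
  bounded as long as \<open>N h\<close> is small.
\<close>

lemma polynomial_on_bounded_imp_continuous:
  fixes D :: "'a::real_topological_vector set" and f :: "'a \<Rightarrow> 'b::real_topological_vector"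
  assumes D: "open D" "x \<in> D" and f: "polynomial_on n D f" and bdd: "locally_bounded_at D f x"
  shows "(f \<longlongrightarrow> f x) (at x within D)"
proof (rule topological_tendstoI)
  fix G assume G: "open G" "f x \<in> G"
  have "open ((\<lambda>y. f x + y) -` G)"
    using G(1) by (intro open_vimage continuous_intros)
  then obtain V where V: "balanced_nhd V"
      "\<And>y. (\<forall>i\<in>{..n}. y i \<in> V) \<Longrightarrow> f x + (\<Sum>i\<le>n. 1 *\<^sub>R y i) \<in> G"
    using ex_balanced_nhd_combination[of "{..n}" "(\<lambda>y. f x + y) -` G" "\<lambda>_. 1"] G(2) by auto
  obtain W c where W: "open W" "0 \<in> W" "c > 0" "\<And>w. w \<in> W \<Longrightarrow> x + w \<in> D \<Longrightarrow> (1 / c) *\<^sub>R f (x + w) \<in> V"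
    using bdd[unfolded locally_bounded_at_def, rule_format, OF V(1)] by metis
  define b where "b i N = poly (lagrange_basis n i) (1 / real N) - poly (lagrange_basis n i) 0" for i N
  have "(\<lambda>N. c * b i N) \<longlonglongrightarrow> c * (poly (lagrange_basis n i) 0 - poly (lagrange_basis n i) 0)" for i
    unfolding b_def
    by (intro tendsto_mult tendsto_diff tendsto_const tendsto_poly lim_1_over_n)
  then have lim: "(\<lambda>N. \<bar>c * b i N\<bar>) \<longlonglongrightarrow> 0" for i by (simp add: tendsto_rabs_zero)
  have "eventually (\<lambda>N. \<bar>c * b i N\<bar> < 1) sequentially" for i
    by (rule order_tendstoD(2)[OF lim]) simp
  then have "eventually (\<lambda>N. \<forall>i\<in>{..n}. \<bar>c * b i N\<bar> < 1) sequentially"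
    by (intro eventually_ball_finite) auto
  with eventually_ge_at_top[of 1]
  have "eventually (\<lambda>N. 1 \<le> N \<and> (\<forall>i\<in>{..n}. \<bar>c * b i N\<bar> < 1)) sequentially"
    by (rule eventually_conj)
  then have "\<exists>N. 1 \<le> N \<and> (\<forall>i\<in>{..n}. \<bar>c * b i N\<bar> < 1)"
    by (rule eventually_happens'[OF sequentially_bot])
  then obtain N where N: "1 \<le> N" "\<And>i. i \<le> n \<Longrightarrow> \<bar>c * b i N\<bar> < 1"
    by auto
  define H where "H = (\<Inter>k\<in>{..max 1 (n * N)}. (\<lambda>y. x + real k *\<^sub>R (y - x)) -` D \<inter>
      (\<lambda>y. real k *\<^sub>R (y - x)) -` W)"
  have "open H"
    unfolding H_def using D(1) W(1)
    by (intro open_INT open_Int ballI open_vimage continuous_intros) auto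
  moreover have "x \<in> H" using D(2) W(2) by (auto simp: H_def)
  moreover have "f y \<in> G" if y: "y \<in> H" for y
  proof -
    define h where "h = y - x"
    have hD: "x + real k *\<^sub>R h \<in> D" "real k *\<^sub>R h \<in> W" if "k \<le> max 1 (n * N)" for k
      using y that by (auto simp: H_def h_def)
    have "f (x + real 1 *\<^sub>R h) =
        (\<Sum>i\<le>n. poly (lagrange_basis n i) (real 1 / real N) *\<^sub>R f (x + real (i * N) *\<^sub>R h))"
      using hD by (intro polynomial_on_interpolation[OF f N(1)]) auto
    moreover have "f (x + real 0 *\<^sub>R h) =
        (\<Sum>i\<le>n. poly (lagrange_basis n i) (real 0 / real N) *\<^sub>R f (x + real (i * N) *\<^sub>R h))"
      using hD by (intro polynomial_on_interpolation[OF f N(1)]) auto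
    ultimately have "f y - f x = (\<Sum>i\<le>n. b i N *\<^sub>R f (x + real (i * N) *\<^sub>R h))"
      by (simp add: h_def b_def scaleR_left_diff_distrib sum_subtractf)
    also have "\<dots> = (\<Sum>i\<le>n. 1 *\<^sub>R ((c * b i N) *\<^sub>R ((1 / c) *\<^sub>R f (x + real (i * N) *\<^sub>R h))))"
      using W(3) by simp
    finally have eq: "f y = f x + (\<Sum>i\<le>n. 1 *\<^sub>R ((c * b i N) *\<^sub>R ((1 / c) *\<^sub>R f (x + real (i * N) *\<^sub>R h))))"
      by (simp add: algebra_simps)
    show ?thesis
      unfolding eq
    proof (intro V(2) ballI)
      fix i assume i: "i \<in> {..n}"
      then have "i * N \<le> max 1 (n * N)" by (simp add: le_max_iff_disj)
      then have "(1 / c) *\<^sub>R f (x + real (i * N) *\<^sub>R h) \<in> V" using hD W(4) by blast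
      then show "(c * b i N) *\<^sub>R ((1 / c) *\<^sub>R f (x + real (i * N) *\<^sub>R h)) \<in> V"
        using N(2)[of i] i by (intro balanced_nhdD(3)[OF V(1), of "c * b i N"]) auto
    qed
  qed
  ultimately show "eventually (\<lambda>y. f y \<in> G) (at x within D)"
    unfolding eventually_at_topological by blast
qed

section \<open>Sums of small maps on a product of compact spaces\<close>

lemma continuous_map_add_tvs:
  fixes a b :: "'k \<Rightarrow> 'a::topological_monoid_add"
  assumes "continuous_map T euclidean a" "continuous_map T euclidean b"
  shows "continuous_map T euclidean (\<lambda>k. a k + b k)"
proof -
  have "continuous_map T (prod_topology euclidean euclidean) (\<lambda>k. (a k, b k))"
    using assms by (intro continuous_map_paired[THEN iffD2]) auto
  then have ab: "continuous_map T euclidean (\<lambda>k. (a k, b k))" by simp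
  have "continuous_on UNIV (\<lambda>p::'a \<times> 'a. fst p + snd p)"
    by (intro continuous_intros)
  then show ?thesis
    using continuous_map_compose[OF ab, of euclidean "\<lambda>p. fst p + snd p"] by (simp add: o_def)
qed

text \<open>
  A complete metric of a Polish topological vector space need not be translation invariant.  On
  compact sets this lemma repairs the defect.
\<close>

lemma uniformly_small_translation:
  fixes S :: "'a::{topological_monoid_add, metric_space} set"
  assumes S: "compact S" and e: "e > 0"
  shows "\<exists>d>0. \<forall>s\<in>S. \<forall>w. dist 0 w < d \<longrightarrow> dist s (s + w) < e"
proof (rule ccontr)
  assume "\<not> ?thesis"
  then have "\<exists>s w. s \<in> S \<and> dist 0 w < 1 / real (Suc n) \<and> dist s (s + w) \<ge> e" for n
    by (metis not_le of_nat_0_less_iff zero_less_Suc zero_less_divide_1_iff)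
  then obtain s w where sw: "\<And>n. s n \<in> S" "\<And>n. dist 0 (w n) < 1 / real (Suc n)"
      "\<And>n. dist (s n) (s n + w n) \<ge> e"
    by metis
  obtain l r where r: "strict_mono (r :: nat \<Rightarrow> nat)" "(s \<circ> r) \<longlonglongrightarrow> l"
    using S sw(1) unfolding compact_eq_seq_compact_metric seq_compact_def by metis
  have "(\<lambda>n. dist (w n) 0) \<longlonglongrightarrow> 0"
  proof (rule tendsto_sandwich[OF _ _ tendsto_const LIMSEQ_inverse_real_of_nat])
    show "eventually (\<lambda>n. dist (w n) 0 \<le> inverse (real (Suc n))) sequentially"
      using sw(2) by (intro always_eventually) (simp add: dist_commute inverse_eq_divide less_imp_le)
  qed simp
  then have "w \<longlonglongrightarrow> 0" by (rule metric_tendsto_imp_tendsto[OF tendsto_dist_iff[THEN iffD2]] ) auto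
  then have "(w \<circ> r) \<longlonglongrightarrow> 0" using r(1) by (rule LIMSEQ_subseq_LIMSEQ)
  with r(2) have "(\<lambda>n. dist ((s \<circ> r) n) ((s \<circ> r) n + (w \<circ> r) n)) \<longlonglongrightarrow> dist l (l + 0)"
    by (intro tendsto_dist tendsto_add)
  then have "e \<le> dist l (l + 0)"
    by (rule tendsto_lowerbound) (use sw(3) in auto)
  then show False using e by simp
qed

definition sum_piece :: "'k topology \<Rightarrow> ('k \<Rightarrow> 'a::real_topological_vector) \<Rightarrow> bool" where
  "sum_piece T g \<longleftrightarrow> topspace T \<noteq> {} \<and> compact_space T \<and> Hausdorff_space T \<and>
     continuous_map T euclidean g"

text \<open>
  Suppose that for every \<open>i\<close> there are maps \<open>g\<^sub>i : T\<^sub>i \<rightarrow> X\<close> of the desired kind \<open>P i\<close>, on a compact space,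
  with image arbitrarily close to \<open>0\<close>.  Then they can be chosen such that the map
  \<open>G k = \<Sum>\<^sub>i g\<^sub>i (k\<^sub>i)\<close> on the product of the \<open>T\<^sub>i\<close> exists, is continuous and has small values.  The
  choice is recursive: the set of partial sums of the pieces chosen so far is compact, hence it is
  known how small the next piece has to be.
\<close>

lemma ex_summable_pieces:
  fixes P :: "nat \<Rightarrow> 'k topology \<Rightarrow> ('k \<Rightarrow> 'a::{real_topological_vector, polish_space}) \<Rightarrow> bool"
  assumes ex: "\<And>i d. d > 0 \<Longrightarrow> \<exists>T g. P i T g \<and> sum_piece T g \<and> (\<forall>t\<in>topspace T. dist 0 (g t) < d)"
    and e: "e > 0"
  obtains Ts gs G where "\<And>i. P i (Ts i) (gs i)" "\<And>i. sum_piece (Ts i) (gs i)"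
    "continuous_map (product_topology Ts UNIV) euclidean G"
    "\<And>k. k \<in> topspace (product_topology Ts UNIV) \<Longrightarrow> dist 0 (G k) \<le> e"
    "\<And>k i t. k \<in> topspace (product_topology Ts UNIV) \<Longrightarrow> t \<in> topspace (Ts i) \<Longrightarrow>
       G (k(i := t)) = G k - gs i (k i) + gs i t"
proof -
  \<comment> \<open>A state holds the compact set of partial sums below \<open>i\<close> and the \<open>i\<close>-th piece.\<close>
  define St where "St i = (\<lambda>(S, T, g). compact S \<and> (i = 0 \<longrightarrow> S = {0}) \<and> P i T g \<and> sum_piece T g \<and>
      (\<forall>s\<in>S. \<forall>t\<in>topspace T. dist s (s + g t) < e / 2 ^ Suc i))" for i
  define Nx where "Nx = (\<lambda>(S :: 'a set, T :: 'k topology, g :: 'k \<Rightarrow> 'a) (S', T' :: 'k topology, g' :: 'k \<Rightarrow> 'a).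
      S' = (\<lambda>p. fst p + snd p) ` (S \<times> g ` topspace T))"
  have step: "\<exists>T g. St i (S, T, g)" if "compact S" "i = 0 \<longrightarrow> S = {0}" for i S
  proof -
    obtain d where d: "d > 0" "\<forall>s\<in>S. \<forall>w. dist 0 w < d \<longrightarrow> dist s (s + w) < e / 2 ^ Suc i"
      using uniformly_small_translation[OF \<open>compact S\<close>, of "e / 2 ^ Suc i"] e by auto
    obtain T g where Tg: "P i T g" "sum_piece T g" "\<forall>t\<in>topspace T. dist 0 (g t) < d"
      using ex[OF d(1)] by metis
    have "St i (S, T, g)" unfolding St_def using d Tg that by auto
    then show ?thesis by blast
  qed
  have "\<exists>F. \<forall>i. St i (F i) \<and> Nx (F i) (F (Suc i))"
  proof (rule dependent_nat_choice)
    show "\<exists>x. St 0 x" using step[of "{0}" 0] by auto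
    fix x i assume x: "St i x"
    obtain S T g where [simp]: "x = (S, T, g)" by (cases x)
    have "compact (g ` topspace T)"
      using x image_compactin[of T "topspace T" euclidean g]
      by (auto simp: St_def sum_piece_def compact_space_def)
    then have "compact ((\<lambda>p. fst p + snd p) ` (S \<times> g ` topspace T))"
      using x by (intro compact_continuous_image continuous_intros compact_Times) (auto simp: St_def)
    from step[OF this, of "Suc i"] show "\<exists>y. St (Suc i) y \<and> Nx x y"
      unfolding Nx_def by auto
  qed
  then obtain F where F: "\<And>i. St i (F i)" "\<And>i. Nx (F i) (F (Suc i))" by auto
  define Ts where "Ts i = fst (snd (F i))" for i
  define gs where "gs i = snd (snd (F i))" for i
  define S where "S i = fst (F i)" for i
  have S0: "S 0 = {0}" and P: "\<And>i. P i (Ts i) (gs i)" and piece: "\<And>i. sum_piece (Ts i) (gs i)"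
    and small: "\<And>i s t. s \<in> S i \<Longrightarrow> t \<in> topspace (Ts i) \<Longrightarrow> dist s (s + gs i t) < e / 2 ^ Suc i"
    using F(1) by (auto simp: St_def Ts_def gs_def S_def split_beta)
  have SSuc: "S (Suc i) = (\<lambda>p. fst p + snd p) ` (S i \<times> gs i ` topspace (Ts i))" for i
    using F(2)[of i] by (simp add: Nx_def Ts_def gs_def S_def split_beta)
  define T where "T = product_topology Ts UNIV"
  define s where "s n k = (\<Sum>l<n. gs l (k l))" for n and k :: "nat \<Rightarrow> 'k"
  have kT: "k l \<in> topspace (Ts l)" if "k \<in> topspace T" for k l
    using that by (auto simp: T_def)
  have sS: "s n k \<in> S n" if "k \<in> topspace T" for n k
  proof (induction n)
    case (Suc n)
    then show ?case
      unfolding SSuc s_def using kT[OF that, of n] by (auto intro!: image_eqI[of _ _ "(s n k, gs n (k n))"] simp: s_def)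
  qed (simp add: s_def S0)
  have d1: "dist (s n k) (s (Suc n) k) < e / 2 ^ Suc n" if "k \<in> topspace T" for n k
    using small[OF sS[OF that] kT[OF that], of n] by (simp add: s_def)
  have dm: "dist (s n k) (s (n + m) k) \<le> e / 2 ^ n - e / 2 ^ (n + m)" if k: "k \<in> topspace T" for n m k
  proof (induction m)
    case (Suc m)
    have "dist (s n k) (s (n + Suc m) k) \<le> dist (s n k) (s (n + m) k) + dist (s (n + m) k) (s (Suc (n + m)) k)"
      by (simp add: dist_triangle)
    also have "\<dots> \<le> (e / 2 ^ n - e / 2 ^ (n + m)) + e / 2 ^ Suc (n + m)"
      using Suc d1[OF k, of "n + m"] by linarith
    also have "\<dots> = e / 2 ^ n - e / 2 ^ (n + Suc m)"
      by (simp add: field_simps)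
    finally show ?case .
  qed simp
  have le: "dist (s n k) (s m k) \<le> e / 2 ^ n" if k: "k \<in> topspace T" and "n \<le> m" for n m k
  proof -
    have "dist (s n k) (s m k) \<le> e / 2 ^ n - e / 2 ^ m"
      using dm[OF k, of n "m - n"] that by simp
    also have "\<dots> \<le> e / 2 ^ n" using e by simp
    finally show ?thesis .
  qed
  have lim0: "(\<lambda>n. e / 2 ^ n) \<longlonglongrightarrow> 0"
    using LIMSEQ_divide_realpow_zero[of 2 e] by simp
  have conv: "convergent (\<lambda>n. s n k)" if k: "k \<in> topspace T" for k
  proof (rule Cauchy_convergent, rule metric_CauchyI)
    fix r :: real assume "r > 0"
    then have "eventually (\<lambda>n. e / 2 ^ n < r / 2) sequentially"
      using order_tendstoD(2)[OF lim0, of "r / 2"] by simp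
    then obtain n0 where n0: "e / 2 ^ n0 < r / 2" by (auto simp: eventually_sequentially)
    show "\<exists>M. \<forall>m\<ge>M. \<forall>n\<ge>M. dist (s m k) (s n k) < r"
    proof (intro exI allI impI)
      fix m n assume "m \<ge> n0" "n \<ge> n0"
      then show "dist (s m k) (s n k) < r"
        using le[OF k, of n0 m] le[OF k, of n0 n] n0 dist_triangle3[of "s m k" "s n k" "s n0 k"] by linarith
    qed
  qed
  define G where "G k = lim (\<lambda>n. s n k)" for k
  have lim: "(\<lambda>n. s n k) \<longlonglongrightarrow> G k" if "k \<in> topspace T" for k
    using conv[OF that] unfolding G_def by (simp add: convergent_LIMSEQ_iff)
  have dG: "dist (s n k) (G k) \<le> e / 2 ^ n" if k: "k \<in> topspace T" for n k
    by (rule tendsto_upperbound[OF tendsto_dist[OF tendsto_const lim[OF k]]])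
      (use le[OF k, of n] in \<open>auto simp: eventually_sequentially\<close>)
  have cs: "continuous_map T euclidean (s n)" for n
  proof (induction n)
    case 0
    then show ?case by (simp add: s_def)
  next
    case (Suc n)
    have "continuous_map T euclidean (\<lambda>k. gs n (k n))"
      using continuous_map_compose[OF continuous_map_product_projection[of n UNIV Ts], of euclidean "gs n"]
        piece[of n] by (simp add: T_def sum_piece_def o_def)
    from continuous_map_add_tvs[OF Suc this] show ?case by (simp add: s_def)
  qed
  have "continuous_map T Met_TC.mtopology G"
  proof (rule Met_TC.continuous_map_uniform_limit[where F = sequentially and f = s])
    show "eventually (\<lambda>n. continuous_map T Met_TC.mtopology (s n)) sequentially" using cs by simp
    fix r :: real assume "r > 0"
    from order_tendstoD(2)[OF lim0 this]
    show "eventually (\<lambda>n. \<forall>x\<in>topspace T. G x \<in> UNIV \<and> dist (s n x) (G x) < r) sequentially"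
      by eventually_elim (use dG in \<open>auto intro: le_less_trans\<close>)
  qed simp
  then have cG: "continuous_map T euclidean G" by simp
  have "dist 0 (G k) \<le> e" if "k \<in> topspace T" for k
    using dG[OF that, of 0] by (simp add: s_def)
  moreover have "G (k(i := t)) = G k - gs i (k i) + gs i t"
    if k: "k \<in> topspace T" and t: "t \<in> topspace (Ts i)" for k i t
  proof -
    have "k(i := t) \<in> topspace T" using k t fun_upd_in_product[of k Ts t i] by (simp add: T_def)
    then have "(\<lambda>n. s n (k(i := t))) \<longlonglongrightarrow> G (k(i := t))" by (rule lim)
    moreover have "(\<lambda>n. s n (k(i := t))) \<longlonglongrightarrow> G k - gs i (k i) + gs i t"
    proof (rule Lim_transform_eventually)
      show "(\<lambda>n. s n k - gs i (k i) + gs i t) \<longlonglongrightarrow> G k - gs i (k i) + gs i t"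
        by (intro tendsto_intros lim[OF k])
      show "eventually (\<lambda>n. s n k - gs i (k i) + gs i t = s n (k(i := t))) sequentially"
        using eventually_gt_at_top[of i]
      proof eventually_elim
        case (elim n)
        then have "s n k' = gs i (k' i) + (\<Sum>l\<in>{..<n} - {i}. gs l (k' l))" for k'
          unfolding s_def by (intro sum.remove) auto
        then show ?case by simp
      qed
    qed
    ultimately show ?thesis by (rule LIMSEQ_unique)
  qed
  ultimately show ?thesis
    using that[of Ts gs G] P piece cG unfolding T_def by blast
qed

text \<open>
  A witness of Haar meagerness stays one after translating and scaling its map and after restricting
  it to the closure of a nonempty open set.  With this freedom its image fits into any ball around
  \<open>0\<close>.  The factor \<open>c\<close> undoes the scaling: it makes the witness apply to the set of all \<open>h\<close> with
  \<open>y + c h \<in> N\<close>.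
\<close>

lemma haar_meager_small_piece:
  fixes g :: "'k \<Rightarrow> 'a::{real_topological_vector, metric_space}"
  assumes w: "haar_meager_witness K g N" and c: "c \<noteq> 0" and d: "d > 0"
  shows "\<exists>(T :: 'k topology) g'. sum_piece T g' \<and> second_countable T \<and> (\<forall>t\<in>topspace T. dist 0 (g' t) < d) \<and>
    (\<forall>y. meager_in T {t \<in> topspace T. y + c *\<^sub>R g' t \<in> N})"
proof -
  let ?M = "mtopology_of K"
  have M: "compact_space ?M" "continuous_map ?M euclidean g"
    and mg: "\<And>x. meager_in ?M {k \<in> mspace K. g k \<in> (\<lambda>b. b + x) ` N}"
    using w by (auto simp: haar_meager_witness_def)
  have HM: "Hausdorff_space ?M"
    by (simp add: mtopology_of_def Metric_space.Hausdorff_space_mtopology)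
  obtain k0 where k0: "k0 \<in> mspace K" using w by (auto simp: haar_meager_witness_def)
  define g' where "g' k = (1 / c) *\<^sub>R (g k - g k0)" for k
  have "continuous_on UNIV (\<lambda>x. (1 / c) *\<^sub>R (x - g k0))" by (intro continuous_intros)
  then have cg: "continuous_map ?M euclidean g'"
    using continuous_map_compose[OF M(2), of euclidean "\<lambda>x. (1 / c) *\<^sub>R (x - g k0)"]
    by (simp add: o_def g'_def[abs_def])
  define U where "U = {k \<in> topspace ?M. g' k \<in> ball 0 (d / 2)}"
  have U: "openin ?M U"
    unfolding U_def by (rule openin_continuous_map_preimage[OF cg]) simp
  have k0U: "k0 \<in> U" using k0 d by (simp add: U_def g'_def)
  define L where "L = ?M closure_of U"
  have LK: "L \<subseteq> mspace K" using closure_of_subset_topspace[of ?M U] by (simp add: L_def)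
  have "closedin ?M {k \<in> topspace ?M. g' k \<in> cball 0 (d / 2)}"
    by (rule closedin_continuous_map_preimage[OF cg]) simp
  then have "L \<subseteq> {k \<in> topspace ?M. g' k \<in> cball 0 (d / 2)}"
    unfolding L_def by (rule closure_of_minimal[rotated]) (auto simp: U_def)
  then have "\<forall>t\<in>L. dist 0 (g' t) < d" using d by fastforce
  moreover have "sum_piece (subtopology ?M L) g'"
    unfolding sum_piece_def
  proof (intro conjI)
    show "topspace (subtopology ?M L) \<noteq> {}"
      using k0U closure_of_subset[OF openin_subset[OF U]] LK by (auto simp: L_def)
    show "compact_space (subtopology ?M L)"
      using M(1) by (intro compact_space_subtopology closedin_compact_space) (auto simp: L_def)
    show "Hausdorff_space (subtopology ?M L)" using HM by (rule Hausdorff_space_subtopology)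
    show "continuous_map (subtopology ?M L) euclidean g'"
      using cg by (rule continuous_map_from_subtopology)
  qed
  moreover have "second_countable (subtopology ?M L)"
    using compact_metric_second_countable[OF M(1)] by (rule second_countable_subtopology)
  moreover have "meager_in (subtopology ?M L) {t \<in> L. y + c *\<^sub>R g' t \<in> N}" for y
  proof -
    have "y + c *\<^sub>R g' k \<in> N \<longleftrightarrow> g k \<in> (\<lambda>b. b + (g k0 - y)) ` N" for k
    proof -
      have "y + c *\<^sub>R g' k = g k - (g k0 - y)" using c by (simp add: g'_def algebra_simps)
      moreover have "g k \<in> (\<lambda>b. b + (g k0 - y)) ` N \<longleftrightarrow> g k - (g k0 - y) \<in> N"
        by (force simp: image_iff)
      ultimately show ?thesis by (simp only:)
    qed
    then have "{t \<in> L. y + c *\<^sub>R g' t \<in> N} = {k \<in> mspace K. g k \<in> (\<lambda>b. b + (g k0 - y)) ` N} \<inter> L"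
      using LK by auto
    then show ?thesis
      using meager_in_closure_of_open_subspace[OF mg U] by (simp add: L_def)
  qed
  moreover have "topspace (subtopology ?M L) = L" using LK by auto
  ultimately show ?thesis
    by (intro exI[of _ "subtopology ?M L"] exI[of _ g']) auto
qed

section \<open>Measurable polynomial functions are locally bounded\<close>

text \<open>
  The Steinhaus-type theorem behind the result.  With Lebesgue measure one would argue that, for large
  \<open>m\<close>, the sets \<open>(A m - p) / j\<close> fill most of a ball around \<open>0\<close>, as do their translates by short vectors,
  so that these sets meet.  A set that is not Haar meager need not fill most of any open set in a
  comparable sense, so the shifts \<open>u\<close> are built into the map that tests the sets.  It is a sum \<open>G\<close> of
  two kinds of pieces:

  \<^item> at even indices, one witness for each set \<open>N m\<close> and each \<open>j\<close>, which make the set of all \<open>k\<close> with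
    \<open>p + j G k \<in> N m\<close> meager, by the Kuratowski-Ulam theorem;
  \<^item> at odd indices \<open>i\<close>, a finite discrete piece \<open>q \<mapsto> q u\<^sub>i\<close> with \<open>u\<^sub>i \<in> C i\<close> and \<open>q\<close> ranging over \<open>0\<close> and
    the numbers \<open>1 / j\<close>.

  For generic \<open>k\<close> all points \<open>p + j G k\<close> lie in the Borel parts of the sets \<open>A m\<close>, so for some \<open>m\<close> they
  all lie in \<open>A m\<close> for comeager many \<open>k\<close> in a nonempty open set.  That open set restricts only finitely
  many coordinates.  A late odd coordinate \<open>i\<close> may thus be set to \<open>0\<close> and to \<open>1 / j\<close> without leaving
  the good set, and the second choice turns \<open>p + j h\<close> into \<open>p + j (h + u\<^sub>i / j) = p + u\<^sub>i + j h\<close>.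
\<close>

lemma ex_common_shift:
  fixes D :: "'a::{real_topological_vector, polish_space} set"
  assumes D: "open D" and p: "p \<in> D"
    and A: "\<And>m. D_measurable_set (A m)" "incseq A" "D \<subseteq> (\<Union>m. A m)"
    and J: "finite J" "0 \<notin> J"
    and C: "\<And>i W. open W \<Longrightarrow> 0 \<in> W \<Longrightarrow> W \<inter> C i \<noteq> {}"
  shows "\<exists>m i u h. m \<le> i \<and> u \<in> C i \<and> (\<forall>j\<in>J. p + u + real j *\<^sub>R h \<in> A m)"
proof -
  have "\<exists>B N. B \<in> sets borel \<and> N \<in> sets borel \<and> A m - N \<subseteq> B \<and> B \<subseteq> A m \<and>
      (\<exists>(K :: real metric) g. haar_meager_witness K g N)" for m
    using A(1)[of m] unfolding D_measurable_set_def haar_meager_def by blast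
  then obtain B N where B: "\<And>m. B m \<in> sets borel" and N: "\<And>m. N m \<in> sets borel"
    and BA: "\<And>m. B m \<subseteq> A m" and AB: "\<And>m. A m - N m \<subseteq> B m"
    and wit: "\<And>m. \<exists>(K :: real metric) g. haar_meager_witness K g (N m)"
    by metis
  define Q where "Q = insert 0 ((\<lambda>j. 1 / real j) ` J)"
  have Q: "finite Q" "0 \<in> Q" using J(1) by (auto simp: Q_def)
  \<comment> \<open>The even index \<open>i\<close> stands for the pair \<open>(m, j - 1)\<close> coded by \<open>i div 2\<close>; the shift by one keeps the
    scaling factor nonzero.\<close>
  define P where "P i T g = (if even i
      then second_countable T \<and> (\<forall>y. meager_in T {t \<in> topspace T.
        y + real (Suc (snd (prod_decode (i div 2)))) *\<^sub>R g t \<in> N (fst (prod_decode (i div 2)))})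
      else T = discrete_topology Q \<and> (\<exists>u\<in>C i. g = (\<lambda>q. q *\<^sub>R u)))"
    for i and T :: "real topology" and g :: "real \<Rightarrow> 'a"
  have piece: "\<exists>T g. P i T g \<and> sum_piece T g \<and> (\<forall>t\<in>topspace T. dist 0 (g t) < d)"
    if d: "d > 0" for i d
  proof (cases "even i")
    case True
    obtain K :: "real metric" and g where "haar_meager_witness K g (N (fst (prod_decode (i div 2))))"
      using wit by blast
    from haar_meager_small_piece[OF this, of "real (Suc (snd (prod_decode (i div 2))))" d] d
    obtain T :: "real topology" and g' where "sum_piece T g'" "second_countable T" "\<forall>t\<in>topspace T. dist 0 (g' t) < d"
      "\<forall>y. meager_in T {t \<in> topspace T.
        y + real (Suc (snd (prod_decode (i div 2)))) *\<^sub>R g' t \<in> N (fst (prod_decode (i div 2)))}"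
      by (auto simp del: of_nat_Suc)
    then show ?thesis using True unfolding P_def by (intro exI[of _ T] exI[of _ g']) simp
  next
    case False
    define W where "W = (\<Inter>q\<in>Q. {u::'a. q *\<^sub>R u \<in> ball 0 d})"
    have "open W" unfolding W_def using Q(1) by (intro open_INT ballI open_scaled) auto
    moreover have "0 \<in> W" using d by (simp add: W_def)
    ultimately obtain u where u: "u \<in> W" "u \<in> C i" using C[of W i] by blast
    have "sum_piece (discrete_topology Q) (\<lambda>q. q *\<^sub>R u)"
      using Q by (auto simp: sum_piece_def compact_space_discrete_topology)
    with u False show ?thesis
      unfolding P_def
      by (intro exI[of _ "discrete_topology Q"] exI[of _ "\<lambda>q. q *\<^sub>R u"]) (auto simp: W_def)
  qed
  have "open (\<Inter>j\<in>J. (\<lambda>h. p + real j *\<^sub>R h) -` D)"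
    using J(1) D by (intro open_INT ballI open_vimage continuous_intros) auto
  then obtain e where e: "e > 0" "ball 0 e \<subseteq> (\<Inter>j\<in>J. (\<lambda>h. p + real j *\<^sub>R h) -` D)"
    using p open_contains_ball by (metis (no_types, lifting) INT_I add.right_neutral scaleR_zero_right vimageI2)
  have "e / 2 > 0" using e by simp
  obtain Ts gs G where Ts: "\<And>i. P i (Ts i) (gs i)" "\<And>i. sum_piece (Ts i) (gs i)"
    and cG: "continuous_map (product_topology Ts UNIV) euclidean G"
    and Ge: "\<And>k. k \<in> topspace (product_topology Ts UNIV) \<Longrightarrow> dist 0 (G k) \<le> e / 2"
    and upd: "\<And>k i t. k \<in> topspace (product_topology Ts UNIV) \<Longrightarrow> t \<in> topspace (Ts i) \<Longrightarrow>
       G (k(i := t)) = G k - gs i (k i) + gs i t"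
    using ex_summable_pieces[of P, OF piece \<open>e / 2 > 0\<close>] by metis
  define T where "T = product_topology Ts UNIV"
  note cG = cG[folded T_def] and Ge = Ge[folded T_def] and upd = upd[folded T_def]
  have compl: "compact_space (Ts l)" "Hausdorff_space (Ts l)" for l
    using Ts(2)[of l] by (auto simp: sum_piece_def)
  have T: "compact_space T" "Hausdorff_space T"
    using compl by (auto simp: T_def compact_space_product_topology Hausdorff_space_product_topology)
  have Tne: "topspace T \<noteq> {}"
    using Ts(2) by (auto simp: T_def PiE_eq_empty_iff sum_piece_def)
  have GD: "p + real j *\<^sub>R G k \<in> D" if "k \<in> topspace T" "j \<in> J" for k j
  proof -
    have "G k \<in> ball 0 e" using Ge[OF that(1)] e(1) by simp
    then show ?thesis using e(2) that(2) by blast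
  qed
  have borel: "(\<lambda>h. p + real j *\<^sub>R h) -` S \<in> sets borel" if "S \<in> sets borel" for j :: nat and S
  proof -
    have "(\<lambda>h. p + real j *\<^sub>R h) \<in> borel_measurable borel"
      by (intro borel_measurable_continuous_onI continuous_intros)
    from measurable_sets[OF this that] show ?thesis by simp
  qed
  have BP: "has_baire_property T {k \<in> topspace T. G k \<in> S}" if "S \<in> sets borel" for S
    using has_baire_property_borel_preimage[OF cG that] .
  have Z: "meager_in T {k \<in> topspace T. p + real j *\<^sub>R G k \<in> N m}" (is "meager_in T ?Z")
    if "j \<in> J" for j m
  proof -
    define i where "i = 2 * prod_encode (m, j - 1)"
    have j: "Suc (j - 1) = j" using that J(2) by (cases j) auto
    have i: "even i" "prod_decode (i div 2) = (m, j - 1)" by (simp_all add: i_def)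
    then have sc: "second_countable (Ts i)"
      and mg: "\<And>y. meager_in (Ts i) {t \<in> topspace (Ts i). y + real j *\<^sub>R gs i t \<in> N m}"
      using Ts(1)[of i] j by (auto simp: P_def)
    show ?thesis
      unfolding T_def
    proof (rule meager_if_sections_meager[where Ts = Ts and i = i, OF compl sc], unfold T_def[symmetric])
      show "has_baire_property T ?Z" using BP[OF borel[OF N]] by simp
      fix y assume y: "y \<in> topspace T"
      have "{t \<in> topspace (Ts i). y(i := t) \<in> ?Z} \<subseteq>
          {t \<in> topspace (Ts i). (p + real j *\<^sub>R (G y - gs i (y i))) + real j *\<^sub>R gs i t \<in> N m}"
        using upd[OF y] by (auto simp: scaleR_right_distrib add.assoc)
      with mg show "meager_in (Ts i) {t \<in> topspace (Ts i). y(i := t) \<in> ?Z}"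
        by (rule meager_in_subset)
    qed
  qed
  define E where "E m = {k \<in> topspace T. \<forall>j\<in>J. p + real j *\<^sub>R G k \<in> B m}" for m
  have cover: "topspace T \<subseteq> (\<Union>m. E m) \<union> (\<Union>m. \<Union>j\<in>J. {k \<in> topspace T. p + real j *\<^sub>R G k \<in> N m})"
  proof
    fix k assume k: "k \<in> topspace T"
    have *: "k \<in> (\<Union>m. E m)" if nN: "\<And>m j. j \<in> J \<Longrightarrow> p + real j *\<^sub>R G k \<notin> N m"
    proof -
      have "\<forall>j\<in>J. \<exists>m. p + real j *\<^sub>R G k \<in> A m" using GD[OF k] A(3) by blast
      then obtain \<mu> where \<mu>: "\<And>j. j \<in> J \<Longrightarrow> p + real j *\<^sub>R G k \<in> A (\<mu> j)" by metis
      obtain M where M: "\<And>j. j \<in> J \<Longrightarrow> \<mu> j \<le> M"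
        using J(1) finite_nat_set_iff_bounded_le[of "\<mu> ` J"] by auto
      have "p + real j *\<^sub>R G k \<in> B M" if "j \<in> J" for j
        using \<mu>[OF that] M[OF that] nN[OF that] AB[of M] incseqD[OF A(2), of "\<mu> j" M] by blast
      then show ?thesis using k by (auto simp: E_def)
    qed
    show "k \<in> (\<Union>m. E m) \<union> (\<Union>m. \<Union>j\<in>J. {k \<in> topspace T. p + real j *\<^sub>R G k \<in> N m})"
    proof (cases "\<exists>m. \<exists>j\<in>J. p + real j *\<^sub>R G k \<in> N m")
      case True
      then show ?thesis using k by auto
    next
      case False
      then show ?thesis by (intro UnI1 *) auto
    qed
  qed
  have "meager_in T (\<Union>m. \<Union>j\<in>J. {k \<in> topspace T. p + real j *\<^sub>R G k \<in> N m})"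
    using Z J(1) by (intro meager_in_UN) (auto intro: countable_finite)
  then have "meager_in T (topspace T)" if "meager_in T (\<Union>m. E m)"
    using meager_in_subset[OF meager_in_Un[OF that] cover] by simp
  then have "\<not> meager_in T (\<Union>m. E m)"
    using nonmeager_open[OF T _ Tne] by auto
  then obtain m where m: "\<not> meager_in T (E m)"
    using meager_in_UN[of UNIV T E] by auto
  have "has_baire_property T (E m)"
  proof -
    have "(\<Inter>j\<in>J. (\<lambda>h. p + real j *\<^sub>R h) -` B m) \<in> sets borel"
    proof (cases "J = {}")
      case False
      then show ?thesis using J(1) borel[OF B] by (intro sets.finite_INT) auto
    qed simp
    from BP[OF this] show ?thesis by (simp add: E_def)
  qed
  then obtain X where X: "openin T X" "meager_in T ((E m - X) \<union> (X - E m))"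
    unfolding has_baire_property_def by blast
  have "X \<noteq> {}" using X(2) m by auto
  then obtain k1 where "k1 \<in> X" by blast
  then obtain V where V: "finite {i. V i \<noteq> topspace (Ts i)}" "\<And>i. openin (Ts i) (V i)"
      "k1 \<in> Pi\<^sub>E UNIV V" "Pi\<^sub>E UNIV V \<subseteq> X"
    using X(1) unfolding T_def openin_product_topology_alt by auto
  \<comment> \<open>An odd coordinate on which the open box imposes no condition, with index at least \<open>m\<close>\<close>
  obtain b where b: "\<And>i. V i \<noteq> topspace (Ts i) \<Longrightarrow> i < b"
    using V(1) unfolding finite_nat_set_iff_bounded by blast
  define i where "i = Suc (2 * max b m)"
  have "\<not> i < b" by (simp add: i_def)
  then have i: "odd i" "m \<le> i" "V i = topspace (Ts i)"
    using b[of i] by (auto simp: i_def)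
  obtain u where u: "Ts i = discrete_topology Q" "u \<in> C i" "gs i = (\<lambda>q. q *\<^sub>R u)"
    using Ts(1)[of i] i(1) by (auto simp: P_def)
  have "meager_in T (X - E m)" using X(2) by (rule meager_in_subset) auto
  then obtain \<F> where \<F>: "countable \<F>" "\<forall>F\<in>\<F>. closedin T F \<and> T interior_of F = {}" "X - E m \<subseteq> \<Union>\<F>"
    unfolding meager_in_iff_closed_cover by blast
  \<comment> \<open>The points of \<open>Q\<close> are isolated in \<open>Ts i\<close>, so a generic point stays generic when its \<open>i\<close>-th
    coordinate is replaced by any \<open>q \<in> Q\<close>.\<close>
  define slice where "slice = (\<lambda>(q, F). {y \<in> topspace T. \<forall>t\<in>{q}. y(i := t) \<in> F})"
  have "\<exists>k\<in>Pi\<^sub>E UNIV V. k \<notin> \<Union>(slice ` (Q \<times> \<F>))"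
  proof (rule Baire_point_avoiding[OF T])
    show "countable (slice ` (Q \<times> \<F>))" using Q(1) \<F>(1) by (auto intro: countable_finite)
    show "closedin T F \<and> T interior_of F = {}" if F: "F \<in> slice ` (Q \<times> \<F>)" for F
    proof -
      obtain q F' where q: "F = slice (q, F')" "q \<in> Q" "F' \<in> \<F>" using F by auto
      then have "openin (Ts i) {q}" using u(1) by simp
      then show ?thesis
        using nowhere_dense_slice[of Ts F' i "{q}"] \<F>(2) q unfolding slice_def T_def by simp
    qed
    show "openin T (Pi\<^sub>E UNIV V)"
      unfolding T_def using V(1,2) by (intro product_topology_basis) auto
    show "Pi\<^sub>E UNIV V \<noteq> {}" using V(3) by blast
  qed
  then obtain k where k: "k \<in> Pi\<^sub>E UNIV V" "k \<notin> \<Union>(slice ` (Q \<times> \<F>))" by (rule bexE)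
  have kT: "k \<in> topspace T" using k(1) V(4) openin_subset[OF X(1)] by blast
  have kq: "k(i := q) \<in> E m" if q: "q \<in> Q" for q
  proof -
    have "q \<in> V i" using q i(3) u(1) by simp
    then have "k(i := q) \<in> Pi\<^sub>E UNIV V" using k(1) by auto
    then have "k(i := q) \<in> X" using V(4) by blast
    moreover have "k(i := q) \<notin> F" if "F \<in> \<F>" for F
      using k(2) kT q that by (auto simp: slice_def)
    ultimately show ?thesis using \<F>(3) by blast
  qed
  define h where "h = G (k(i := 0))"
  have "p + u + real j *\<^sub>R h \<in> A m" if j: "j \<in> J" for j
  proof -
    have jQ: "1 / real j \<in> Q" using j by (auto simp: Q_def)
    have "k(i := 0) \<in> topspace T" using kq[OF Q(2)] by (simp add: E_def)
    then have "G (k(i := 1 / real j)) = h + (1 / real j) *\<^sub>R u"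
      using upd[of "k(i := 0)" "1 / real j" i] jQ u by (simp add: h_def)
    moreover have "p + real j *\<^sub>R G (k(i := 1 / real j)) \<in> A m"
      using kq[OF jQ] j BA by (auto simp: E_def)
    moreover have "j \<noteq> 0" using j J(2) by metis
    ultimately show ?thesis by (simp add: algebra_simps)
  qed
  then show ?thesis using i(2) u(2) by blast
qed

text \<open>
  The vanishing difference solved for its first term: \<open>f x\<close> is a fixed combination of the values of \<open>f\<close>
  at \<open>x + h, \<dots>, x + (n + 1) h\<close>.
\<close>

lemma polynomial_on_recursion:
  assumes f: "polynomial_on n D f" and x: "\<And>j. j \<le> Suc n \<Longrightarrow> x + real j *\<^sub>R h \<in> D"
  shows "f x = (\<Sum>j\<in>{1..Suc n}. ((-1) ^ Suc j * real (Suc n choose j)) *\<^sub>R f (x + real j *\<^sub>R h))"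
proof -
  have xD: "x \<in> D" using x[of 0] by simp
  have "0 = (-1) ^ Suc n *\<^sub>R fdiff (Suc n) h f x"
    using f xD x by (simp add: polynomial_on_def)
  also have "\<dots> = (\<Sum>j=0..Suc n. ((-1) ^ j * real (Suc n choose j)) *\<^sub>R f (x + real j *\<^sub>R h))"
    unfolding fdiff_def scaleR_sum_right
  proof (rule sum.cong[OF refl])
    fix j assume "j \<in> {0..Suc n}"
    then have "Suc n + (Suc n - j) = 2 * (Suc n - j) + j" by auto
    then have "(-1 :: real) ^ Suc n * (-1) ^ (Suc n - j) = (-1) ^ j"
      by (metis power_add power_mult power_minus1_even mult_1 power_even_eq power_one power2_minus)
    then show "(-1) ^ Suc n *\<^sub>R ((-1) ^ (Suc n - j) * real (Suc n choose j)) *\<^sub>R f (x + real j *\<^sub>R h) =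
        ((-1) ^ j * real (Suc n choose j)) *\<^sub>R f (x + real j *\<^sub>R h)"
      by (simp only: scaleR_scaleR mult.assoc[symmetric])
  qed
  also have "\<dots> = f x + (\<Sum>j\<in>{1..Suc n}. ((-1) ^ j * real (Suc n choose j)) *\<^sub>R f (x + real j *\<^sub>R h))"
    by (subst sum.atLeast_Suc_atMost) auto
  also have "\<dots> = f x - (\<Sum>j\<in>{1..Suc n}. ((-1) ^ Suc j * real (Suc n choose j)) *\<^sub>R f (x + real j *\<^sub>R h))"
    by (simp add: sum_negf del: sum.cl_ivl_Suc)
  finally show ?thesis by simp
qed

text \<open>
  If boundedness with respect to \<open>U\<close> fails at \<open>p\<close>, then every neighbourhood of \<open>0\<close> contains some \<open>u\<close> with
  \<open>f (p + u) \<notin> (i + 1) U\<close>, for each \<open>i\<close>.  Apply \<open>ex_common_shift\<close> to these sets of \<open>u\<close> and to the preimages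
  of \<open>(m + 1) V\<close>, where \<open>V\<close> is so small that the recursion for \<open>f\<close> maps vectors of \<open>V\<close> into \<open>U\<close>: the values of \<open>f\<close> at \<open>p + u + j h\<close> lie in \<open>(m + 1) V\<close> for \<open>j = 1, \<dots>, n + 1\<close>.  Hence
  \<open>f (p + u)\<close>, a fixed combination of them, lies in \<open>(m + 1) U\<close>, which contradicts \<open>m \<le> i\<close>.
\<close>

lemma D_measurable_polynomial_locally_bounded:
  fixes D :: "'a::{real_topological_vector, polish_space} set"
    and f :: "'a \<Rightarrow> 'b::real_topological_vector"
  assumes D: "open D" "p \<in> D" and f: "D_measurable_on D f" "polynomial_on n D f"
  shows "locally_bounded_at D f p"
  unfolding locally_bounded_at_def
proof (intro allI impI, rule ccontr)
  fix U :: "'b set" assume U: "balanced_nhd U"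
  assume neg: "\<not> (\<exists>W c. open W \<and> 0 \<in> W \<and> c > 0 \<and> (\<forall>w\<in>W. p + w \<in> D \<longrightarrow> (1 / c) *\<^sub>R f (p + w) \<in> U))"
  define a where "a j = (-1) ^ Suc j * real (Suc n choose j)" for j
  obtain V where V: "balanced_nhd V"
      "\<And>y. (\<forall>j\<in>{1..Suc n}. y j \<in> V) \<Longrightarrow> (\<Sum>j\<in>{1..Suc n}. a j *\<^sub>R y j) \<in> U"
    using ex_balanced_nhd_combination[of "{1..Suc n}" U a] balanced_nhdD[OF U] by auto
  define A where "A m = {x \<in> D. (1 / real (Suc m)) *\<^sub>R f x \<in> V}" for m
  define C where "C i = {u. p + u \<in> D \<and> (1 / real (Suc i)) *\<^sub>R f (p + u) \<notin> U}" for i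
  have "\<exists>m i u h. m \<le> i \<and> u \<in> C i \<and> (\<forall>j\<in>{1..Suc n}. p + u + real j *\<^sub>R h \<in> A m)"
  proof (rule ex_common_shift[OF D])
    show "D_measurable_set (A m)" for m
      using f(1) open_scaled[OF balanced_nhdD(1)[OF V(1)], of "1 / real (Suc m)"]
      unfolding D_measurable_on_def A_def by auto
    show "incseq A"
      unfolding incseq_def A_def using balanced_nhd_scale_mono[OF V(1)] by auto
    show "D \<subseteq> (\<Union>m. A m)"
      unfolding A_def using balanced_nhd_absorbs[OF V(1)] by auto
    show "W \<inter> C i \<noteq> {}" if "open W" "0 \<in> W" for W i
    proof -
      have "\<exists>w\<in>W. p + w \<in> D \<and> (1 / real (Suc i)) *\<^sub>R f (p + w) \<notin> U"
        using neg that by (metis of_nat_0_less_iff zero_less_Suc)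
      then show ?thesis by (auto simp: C_def)
    qed
  qed auto
  then obtain m i u h where *: "m \<le> i" "u \<in> C i" "\<And>j. j \<in> {1..Suc n} \<Longrightarrow> p + u + real j *\<^sub>R h \<in> A m"
    by metis
  have "p + u + real j *\<^sub>R h \<in> D" if "j \<le> Suc n" for j
    using *(2) *(3)[of j] that by (cases "j = 0") (auto simp: C_def A_def)
  from polynomial_on_recursion[OF f(2) this]
  have "(1 / real (Suc m)) *\<^sub>R f (p + u) =
      (\<Sum>j\<in>{1..Suc n}. a j *\<^sub>R ((1 / real (Suc m)) *\<^sub>R f (p + u + real j *\<^sub>R h)))"
    unfolding a_def by (simp only: scaleR_sum_right scaleR_scaleR mult.commute)
  also have "\<dots> \<in> U" using *(3) by (intro V(2)) (auto simp: A_def)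
  finally have "(1 / real (Suc i)) *\<^sub>R f (p + u) \<in> U"
    by (rule balanced_nhd_scale_mono[OF U]) (use *(1) in simp_all)
  then show False using *(2) by (simp add: C_def)
qed

section \<open>Continuity\<close>

theorem theorem6:
  fixes D :: "'a::{real_topological_vector, polish_space} set"
    and f :: "'a \<Rightarrow> 'b::real_topological_vector"
    and n :: nat
  assumes "D \<noteq> {}" and "open D" and "convex D"
    and "n \<ge> 1"
    and "D_measurable_on D f"
    and "polynomial_on n D f"
  shows "continuous_on D f"
  unfolding continuous_on_def
proof
  fix x assume "x \<in> D"
  with assms show "(f \<longlongrightarrow> f x) (at x within D)"
    by (intro polynomial_on_bounded_imp_continuous D_measurable_polynomial_locally_bounded)
qed

end
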